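(* Let $\boldsymbol x^*\in\mathbb{U}^n$ and let $\boldsymbol a_1,\dots,\boldsymbol a_m\sim\mathcal N(\boldsymbol 0,\boldsymbol I_n)$ be independent random vectors in $\mathbb{R}^n$. Let $d_0\ge\tau_{k-1}$ and $\boldsymbol X=\boldsymbol x\boldsymbol x^\top$ with $\boldsymbol x\in\mathbb{U}^n$ fixed. Then, with probability at least $p_{\mathrm{bdd}}=\left[\frac{\gamma\left(\frac{d_0}{2},\frac12\right)}{\sqrt\pi}\right]^m$, $$F(\boldsymbol X)\ge\frac{1-\rho_{\boldsymbol x}^2}{2}\sum_{i=1}^m(\tilde a_{i1}^2-\tilde a_{i2}^2)^2-\sqrt{1-\rho_{\boldsymbol x}^2}\,\max\{\delta,d_0-\tau_{k-1}\}\sum_{i=1}^m(\tilde a_{i1}^2+\tilde a_{i2}^2)-\frac m2\max\left\{\delta^2+2\delta d_0,\delta_{\mathrm{sq}}\right\},$$ where $\rho_{\boldsymbol x}=|\boldsymbol x^{*\top}\boldsymbol x|$, and $\tilde a_{i1},\tilde a_{i2}$ are the first two entries of $\tilde{\boldsymbol a}_i=\boldsymbol R^\top\boldsymbol a_i$, with $\boldsymbol R\boldsymbol D\boldsymbol R^\top$ the spectral decomposition of $\boldsymbol x^*\boldsymbol x^{*\top}-\boldsymbol x\boldsymbol x^\top$.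
   Context: $\mathbb{U}^n$ is the unit sphere of $\mathbb{R}^n$, $n\ge 2$. $\gamma(w,\alpha)=\int_0^w t^{\alpha-1}e^{-t}\,\mathrm dt$ is the lower incomplete gamma function. Quantizer: let $k\ge2$, with thresholds $0=\tau_0<\tau_1<\dots<\tau_{k-1}<\tau_k=+\infty$ and real symbols $s_1,\dots,s_k$ with $\tau_{j-1}<s_j<\tau_j$. Define $\mathcal Q(u)=s_j$ whenever $\tau_{j-1}\le u<\tau_j$. Its precision is $\delta=\max_{1\le j\le k-1}(\tau_j-\tau_{j-1})$, and $\delta_{\mathrm{sq}}=\max_{1\le j\le k}(s_j^2-\tau_{j-1}^2)$. Measurements: $y_i=\mathcal Q(|\boldsymbol a_i^\top\boldsymbol x^*|^2)$, $i=1,\dots,m$. Let $j(i)$ denote the index with $y_i=s_{j(i)}$, and let $\boldsymbol A_i=\boldsymbol a_i\boldsymbol a_i^\top$. Cost: let $f(u)=\frac12u^2$ if $u\le0$ and $f(u)=0$ otherwise (with $f(+\infty)=0$). Define $$F(\boldsymbol X)=\sum_{i=1}^m\left[f\left(\tau_{j(i)}-\mathrm{Tr}(\boldsymbol A_i\boldsymbol X)\right)+f\left(\mathrm{Tr}(\boldsymbol A_i\boldsymbol X)-\tau_{j(i)-1}\right)\right].$$ Spectral decomposition convention: $\boldsymbol R$ is orthogonal and $\boldsymbol D$ is diagonal, ordered so that the (at most two) nonzero eigenvalues occupy the first two diagonal positions. *)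

theory Defs
  imports "HOL-Probability.Probability"
begin

definition lower_incomplete_gamma :: "real \<Rightarrow> real \<Rightarrow> real" where
  "lower_incomplete_gamma w \<alpha> = integral {0..w} (\<lambda>t. t powr (\<alpha> - 1) * exp (- t))"

text \<open>Thresholds are extended reals, since the last one is \<open>+\<infinity>\<close>; all others are finite as a
  consequence of the strict ordering. Symbols are indexed from 1.\<close>

definition is_quantizer :: "nat \<Rightarrow> (nat \<Rightarrow> ereal) \<Rightarrow> (nat \<Rightarrow> real) \<Rightarrow> bool" where
  "is_quantizer k \<tau> s \<longleftrightarrow>
     k \<ge> 2 \<and> \<tau> 0 = 0 \<and> \<tau> k = \<infinity> \<and> (\<forall>j\<in>{1..k}. \<tau> (j - 1) < \<tau> j) \<and>
     (\<forall>j\<in>{1..k}. \<tau> (j - 1) < ereal (s j) \<and> ereal (s j) < \<tau> j)"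

text \<open>Only meaningful for \<open>u \<ge> 0\<close>, where the cell containing \<open>u\<close> exists and is unique.\<close>

definition quantize :: "nat \<Rightarrow> (nat \<Rightarrow> ereal) \<Rightarrow> (nat \<Rightarrow> real) \<Rightarrow> real \<Rightarrow> real" where
  "quantize k \<tau> s u = s (THE j. j \<in> {1..k} \<and> \<tau> (j - 1) \<le> ereal u \<and> ereal u < \<tau> j)"

definition symbol_index :: "nat \<Rightarrow> (nat \<Rightarrow> real) \<Rightarrow> real \<Rightarrow> nat" where
  "symbol_index k s y = (THE j. j \<in> {1..k} \<and> y = s j)"

definition precision :: "nat \<Rightarrow> (nat \<Rightarrow> ereal) \<Rightarrow> real" where
  "precision k \<tau> = (MAX j\<in>{1..k - 1}. real_of_ereal (\<tau> j) - real_of_ereal (\<tau> (j - 1)))"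

definition precision_sq :: "nat \<Rightarrow> (nat \<Rightarrow> ereal) \<Rightarrow> (nat \<Rightarrow> real) \<Rightarrow> real" where
  "precision_sq k \<tau> s = (MAX j\<in>{1..k}. (s j)\<^sup>2 - (real_of_ereal (\<tau> (j - 1)))\<^sup>2)"

definition outer :: "real^'n \<Rightarrow> real^'n^'n" where
  "outer v = (\<chi> i j. v $ i * v $ j)"

text \<open>The value at \<open>-\<infinity>\<close> is irrelevant: \<open>neg_half_sq\<close> is only applied to reals and \<open>+\<infinity>\<close>.\<close>

definition neg_half_sq :: "ereal \<Rightarrow> real" where
  "neg_half_sq u = (if u \<le> 0 then (real_of_ereal u)\<^sup>2 / 2 else 0)"

definition cost ::
  "nat \<Rightarrow> (nat \<Rightarrow> ereal) \<Rightarrow> (nat \<Rightarrow> real) \<Rightarrow> nat \<Rightarrow> (nat \<Rightarrow> real^'n) \<Rightarrow> (nat \<Rightarrow> real) \<Rightarrow> real^'n^'n \<Rightarrow> real"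
where
  "cost k \<tau> s m a y X = (\<Sum>i=1..m.
     let j = symbol_index k s (y i); t = ereal (trace (outer (a i) ** X))
     in neg_half_sq (\<tau> j - t) + neg_half_sq (t - \<tau> (j - 1)))"

definition standard_gaussian :: "'w measure \<Rightarrow> ('w \<Rightarrow> real^'n) \<Rightarrow> bool" where
  "standard_gaussian M g \<longleftrightarrow>
     distributed M lborel g (\<lambda>v. ennreal (exp (- (norm v)\<^sup>2 / 2) / sqrt (2 * pi) ^ CARD('n)))"

text \<open>Finite index types carry no order, so the first two positions are given by two distinct
  indices \<open>p\<close> and \<open>q\<close>. Every diagonal entry of \<open>D\<close> outside them vanishes; the entries at \<open>p\<close> and
  \<open>q\<close> may vanish too.\<close>

definition spectral_decomposition ::
  "'n \<Rightarrow> 'n \<Rightarrow> real^'n^'n \<Rightarrow> real^'n^'n \<Rightarrow> real^'n^'n \<Rightarrow> bool" where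
  "spectral_decomposition p q R D A \<longleftrightarrow>
     p \<noteq> q \<and> orthogonal_matrix R \<and> (\<forall>i j. i \<noteq> j \<longrightarrow> D $ i $ j = 0) \<and>
     A = R ** D ** transpose R \<and> (\<forall>i. D $ i $ i \<noteq> 0 \<longrightarrow> i = p \<or> i = q)"

end

theory Submission
  imports Defs
begin

text \<open>
  Write \<open>u = (a \<bullet> xs)\<^sup>2\<close>, \<open>v = (a \<bullet> x)\<^sup>2\<close>, \<open>T = \<tau> (k - 1)\<close>, \<open>\<rho> = xs \<bullet> x = cos \<theta>\<close> and let \<open>r\<close> be the
  length of the projection of \<open>a\<close> to the plane of \<open>xs\<close> and \<open>x\<close> (if \<open>x = \<plusminus> xs\<close>, then \<open>u = v\<close> and the
  bound is trivial). The spectral decomposition gives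
  \<open>u - v = \<plusminus> sin \<theta> * (b\<^sub>p\<^sup>2 - b\<^sub>q\<^sup>2)\<close> and \<open>b\<^sub>p\<^sup>2 + b\<^sub>q\<^sup>2 = r\<^sup>2\<close>, so the bound is a sum of bounds on single
  samples, and by independence it suffices that a single sample satisfies its bound with
  probability at least \<open>P (u \<le> d\<^sub>0)\<close>.

  The event \<open>u \<le> d\<^sub>0\<close> does not imply the bound of the sample: in the unbounded last cell, \<open>v\<close> may be
  arbitrarily large. But if \<open>u \<le> d\<^sub>0\<close> and the bound fails, then
  \<open>T \<le> u \<le> d\<^sub>0 < v\<close> and \<open>(u - v)\<^sup>2 > 2 (d\<^sub>0 - T) r\<^sup>2 sin \<theta>\<close>, whereas the bound holds whenever
  \<open>(u - v)\<^sup>2 \<le> 2 (d\<^sub>0 - T) r\<^sup>2 sin \<theta>\<close>. The first of these events is at most as likely as the second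
  one together with \<open>u > d\<^sub>0\<close>: by rotation invariance it suffices to compare the two events on each
  circle of the plane, where they are unions of arcs.
\<close>

subsection \<open>The standard Gaussian measure\<close>

lemma nn_integral_lborel_translate:
  fixes f :: "'a::euclidean_space \<Rightarrow> ennreal"
  assumes [measurable]: "f \<in> borel_measurable borel"
  shows "(\<integral>\<^sup>+x. f (c + x) \<partial>lborel) = (\<integral>\<^sup>+x. f x \<partial>lborel)"
proof -
  have "(\<integral>\<^sup>+x. f x \<partial>distr lborel borel ((+) c)) = (\<integral>\<^sup>+x. f (c + x) \<partial>lborel)"
    by (subst nn_integral_distr) auto
  then show ?thesis by (simp add: lborel_distr_plus)
qed

lemma orthogonal_transformation_measurable:
  fixes T :: "'a::euclidean_space \<Rightarrow> 'a"
  assumes "orthogonal_transformation T"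
  shows "T \<in> borel_measurable borel"
  using assms linear_continuous_on[of T UNIV]
  by (auto simp: orthogonal_transformation_def linear_linear intro: borel_measurable_continuous_onI)

text \<open>Both sides, multiplied by the volume of the unit ball \<open>B\<close>, equal the double integral of
  \<open>indicator A (T x) * indicator B (y - T x)\<close>: integrate out \<open>y\<close> first, or translate \<open>x\<close> by
  \<open>inv T y\<close>.\<close>

lemma lborel_distr_orthogonal:
  fixes T :: "'a::euclidean_space \<Rightarrow> 'a"
  assumes T: "orthogonal_transformation T"
  shows "distr lborel borel T = lborel"
proof (rule measure_eqI)
  show "sets (distr lborel borel T) = sets lborel" by simp
  fix A assume "A \<in> sets (distr lborel borel T)"
  then have A[measurable]: "A \<in> sets borel" by simp
  define B where "B = ball (0::'a) 1"
  have [measurable]: "B \<in> sets borel" by (simp add: B_def)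
  note [measurable] = orthogonal_transformation_measurable[OF T]
  have lin: "linear T" and nT: "norm (T x) = norm x" for x
    using T by (auto simp: orthogonal_transformation)
  have surj: "T (inv T y) = y" for y
    using orthogonal_transformation_surj[OF T] by (simp add: surj_f_inv_f)
  \<comment> \<open>The volume of \<open>B\<close> is cancelled at the end, so it must be neither 0
    nor infinite.\<close>
  have B0: "emeasure lborel B \<noteq> 0" "emeasure lborel B \<noteq> \<infinity>"
    unfolding B_def using content_ball_gt_0_iff[of "0::'a" 1]
    by (auto simp: measure_def emeasure_lborel_ball_finite less_top[symmetric])
  have "emeasure (distr lborel borel T) A * emeasure lborel B
      = (\<integral>\<^sup>+x. indicator A (T x) * (\<integral>\<^sup>+y. indicator B y \<partial>lborel) \<partial>lborel)"
    using nn_integral_distr[of T lborel borel "indicator A"]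
    by (subst nn_integral_multc) auto
  also have "\<dots> = (\<integral>\<^sup>+x. indicator A (T x) * (\<integral>\<^sup>+y. indicator B (- T x + y) \<partial>lborel) \<partial>lborel)"
    by (subst nn_integral_lborel_translate) auto
  also have "\<dots> = (\<integral>\<^sup>+x. \<integral>\<^sup>+y. indicator A (T x) * indicator B (- T x + y) \<partial>lborel \<partial>lborel)"
    by (simp add: nn_integral_cmult)
  also have "\<dots> = (\<integral>\<^sup>+y. \<integral>\<^sup>+x. indicator A (T x) * indicator B (- T x + y) \<partial>lborel \<partial>lborel)"
    by (rule lborel_pair.Fubini'[symmetric]) measurable
  also have "\<dots> = (\<integral>\<^sup>+y. \<integral>\<^sup>+x. indicator A (T (inv T y + x)) * indicator B (- T (inv T y + x) + y) \<partial>lborel \<partial>lborel)"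
    by (subst nn_integral_lborel_translate[where f="\<lambda>x. indicator A (T x) * indicator B (- T x + y)" for y]) auto
  \<comment> \<open>By linearity \<open>T (inv T y + x) = y + T x\<close>. What is left in the
    second factor is \<open>- T x\<close>, which lies in the ball iff \<open>x\<close> does.\<close>
  also have "\<dots> = (\<integral>\<^sup>+y. \<integral>\<^sup>+x. indicator A (T x + y) * indicator B x \<partial>lborel \<partial>lborel)"
    by (simp add: linear_add[OF lin] surj B_def indicator_def nT add.commute)
  also have "\<dots> = (\<integral>\<^sup>+x. \<integral>\<^sup>+y. indicator A (T x + y) * indicator B x \<partial>lborel \<partial>lborel)"
    by (rule lborel_pair.Fubini'[symmetric]) measurable
  also have "\<dots> = (\<integral>\<^sup>+x. (\<integral>\<^sup>+y. indicator A (T x + y) \<partial>lborel) * indicator B x \<partial>lborel)"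
    by (simp add: nn_integral_multc)
  also have "\<dots> = (\<integral>\<^sup>+x. (\<integral>\<^sup>+y. indicator A y \<partial>lborel) * indicator B x \<partial>lborel)"
    by (subst nn_integral_lborel_translate) auto
  also have "\<dots> = emeasure lborel A * emeasure lborel B"
    by (simp add: nn_integral_cmult)
  finally show "emeasure (distr lborel borel T) A = emeasure lborel A"
    using B0 by (simp add: mult.commute[of _ "emeasure lborel B"] ennreal_mult_cancel_left)
qed

definition std_gaussian_density :: "real^'n \<Rightarrow> real" where
  "std_gaussian_density v = exp (- (norm v)\<^sup>2 / 2) / sqrt (2 * pi) ^ CARD('n)"

text \<open>The common law of the samples \<open>a i\<close>: single-sample probabilities are
  computed on \<open>real^'n\<close>, away from the underlying space \<open>M\<close>.\<close>

definition std_gaussian_measure :: "(real^'n) measure" where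
  "std_gaussian_measure = density lborel (\<lambda>v. ennreal (std_gaussian_density v))"

lemma std_gaussian_density_measurable [measurable]:
  "std_gaussian_density \<in> borel_measurable borel"
  unfolding std_gaussian_density_def[abs_def] by measurable

lemma sets_std_gaussian [simp, measurable_cong]: "sets std_gaussian_measure = sets borel"
  by (simp add: std_gaussian_measure_def)

lemma space_std_gaussian [simp]: "space std_gaussian_measure = UNIV"
  by (simp add: std_gaussian_measure_def)

text \<open>The density depends on the norm alone, and Lebesgue measure is invariant under
  \<open>T\<close>.\<close>

lemma std_gaussian_orthogonal:
  fixes T :: "real^'n \<Rightarrow> real^'n"
  assumes T: "orthogonal_transformation T"
  shows "distr std_gaussian_measure borel T = std_gaussian_measure"
proof -
  note [measurable] = orthogonal_transformation_measurable[OF T]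
  have "distr (density lborel (\<lambda>v. ennreal (std_gaussian_density (T v)))) borel T
      = density (distr lborel borel T) (\<lambda>v. ennreal (std_gaussian_density v))"
    by (subst density_distr) auto
  then show ?thesis
    using T by (simp add: std_gaussian_measure_def lborel_distr_orthogonal
        std_gaussian_density_def orthogonal_transformation)
qed

lemma std_normal_total: "(\<integral>\<^sup>+x. ennreal (std_normal_density x) \<partial>lborel) = 1"
  by (subst nn_integral_eq_integral) auto

text \<open>The density is a product of one-dimensional normal densities, and every factor other
  than that of coordinate \<open>i\<close> integrates to 1.\<close>

lemma std_gaussian_axis:
  assumes [measurable]: "B \<in> sets borel"
  shows "emeasure (std_gaussian_measure :: (real^'n) measure) {v. v $ i \<in> B}
    = (\<integral>\<^sup>+x. ennreal (std_normal_density x) * indicator B x \<partial>lborel)"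
proof -
  \<comment> \<open>The indicator is absorbed into the factor of \<open>axis i 1\<close>, so that
    the integrand stays a product over \<open>Basis\<close>.\<close>
  define f where "f b x = ennreal (std_normal_density x) * (if b = axis i 1 then indicator B x else 1)"
    for b :: "real^'n" and x
  have [measurable]: "f b \<in> borel_measurable borel" for b
    by (cases "b = axis i 1") (auto simp: f_def[abs_def])
  have M[measurable]: "{v::real^'n. v $ i \<in> B} \<in> sets borel"
  proof -
    have "(\<lambda>v::real^'n. v $ i) -` B \<inter> space borel \<in> sets borel"
      by (rule measurable_sets[of _ _ borel]) (auto intro: borel_measurable_continuous_onI continuous_intros)
    then show ?thesis by (simp add: vimage_def)
  qed
  have dens: "ennreal (std_gaussian_density v) * indicator {v. v $ i \<in> B} v = (\<Prod>b\<in>Basis. f b (v \<bullet> b))"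
    for v :: "real^'n"
  proof -
    have "(\<Prod>b\<in>Basis. f b (v \<bullet> b)) = (\<Prod>b\<in>Basis. ennreal (std_normal_density (v \<bullet> b)))
       * (\<Prod>b\<in>Basis. (if b = axis i 1 then indicator B (v \<bullet> b) else 1))"
      by (simp add: f_def prod.distrib)
    also have "(\<Prod>b\<in>Basis. (if b = axis i 1 then indicator B (v \<bullet> b) else 1 :: ennreal)) = indicator {v. v $ i \<in> B} v"
      by (subst prod.delta) (auto simp: axis_in_Basis_iff inner_axis indicator_def)
    also have "(\<Prod>b\<in>Basis. ennreal (std_normal_density (v \<bullet> b))) = ennreal (std_gaussian_density v)"
    proof -
      have "(\<Prod>b\<in>Basis. std_normal_density (v \<bullet> b)) = (1 / sqrt (2 * pi)) ^ DIM(real^'n) * exp (\<Sum>b\<in>Basis. - (v \<bullet> b)\<^sup>2 / 2)"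
        by (simp add: std_normal_density_def prod.distrib exp_sum prod_dividef power_divide)
      also have "(\<Sum>b\<in>Basis. - (v \<bullet> b)\<^sup>2 / 2) = - (norm v)\<^sup>2 / 2"
        unfolding power2_norm_eq_inner euclidean_inner[of v v]
        by (simp add: sum_negf sum_divide_distrib[symmetric] power2_eq_square)
      finally show ?thesis
        by (simp add: prod_ennreal std_gaussian_density_def power_divide)
    qed
    finally show ?thesis by simp
  qed
  have "emeasure (std_gaussian_measure :: (real^'n) measure) {v. v $ i \<in> B} = (\<integral>\<^sup>+v. (\<Prod>b\<in>Basis. f b (v \<bullet> b)) \<partial>(lborel :: (real^'n) measure))"
    unfolding std_gaussian_measure_def by (subst emeasure_density) (auto simp: dens)
  also have "\<dots> = (\<Prod>b\<in>(Basis::(real^'n) set). (\<integral>\<^sup>+x. f b x \<partial>lborel))"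
    by (rule nn_integral_lborel_prod) auto
  also have "\<dots> = (\<Prod>b\<in>(Basis::(real^'n) set). if b = axis i 1 then (\<integral>\<^sup>+x. ennreal (std_normal_density x) * indicator B x \<partial>lborel) else 1)"
    by (rule prod.cong) (auto simp: f_def std_normal_total)
  also have "\<dots> = (\<integral>\<^sup>+x. ennreal (std_normal_density x) * indicator B x \<partial>lborel)"
    by (subst prod.delta) (auto simp: axis_in_Basis_iff)
  finally show ?thesis .
qed

lemma prob_space_std_gaussian: "prob_space (std_gaussian_measure :: (real^'n) measure)"
proof
  have "emeasure (std_gaussian_measure :: (real^'n) measure) {v. v $ undefined \<in> UNIV} = 1"
    by (subst std_gaussian_axis) (auto simp: std_normal_total)
  then show "emeasure (std_gaussian_measure :: (real^'n) measure) (space std_gaussian_measure) = 1"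
    by simp
qed

text \<open>By rotation invariance \<open>w\<close> may be replaced by a coordinate axis.\<close>

lemma std_gaussian_inner:
  fixes w :: "real^'n"
  assumes [measurable]: "B \<in> sets borel" and "norm w = 1"
  shows "emeasure std_gaussian_measure {v. v \<bullet> w \<in> B}
    = (\<integral>\<^sup>+x. ennreal (std_normal_density x) * indicator B x \<partial>lborel)"
proof -
  obtain T :: "real^'n \<Rightarrow> real^'n" where T: "orthogonal_transformation T" "T (axis undefined 1) = w"
    using orthogonal_transformation_exists_1[of "axis undefined 1" w] assms(2) by auto
  have *: "T v \<bullet> w = v $ undefined" for v
    using T by (metis inner_axis inner_real_def mult.right_neutral orthogonal_transformation_def)
  have [measurable]: "{v. v \<bullet> w \<in> B} \<in> sets borel"
  proof -
    have "(\<lambda>v. v \<bullet> w) -` B \<inter> space borel \<in> sets borel"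
      by (rule measurable_sets[of _ _ borel]) auto
    then show ?thesis by (simp add: vimage_def)
  qed
  have "emeasure std_gaussian_measure {v. v \<bullet> w \<in> B} = emeasure (distr std_gaussian_measure borel T) {v. v \<bullet> w \<in> B}"
    by (simp add: std_gaussian_orthogonal[OF T(1)])
  also have "\<dots> = emeasure std_gaussian_measure {v::real^'n. v $ undefined \<in> B}"
    using orthogonal_transformation_measurable[OF T(1)]
    by (subst emeasure_distr) (auto simp: * vimage_def)
  finally show ?thesis by (simp add: std_gaussian_axis)
qed

section \<open>The squared normal variable and the incomplete gamma function\<close>

lemma lower_incomplete_gamma_half:
  assumes "0 \<le> d"
  shows "(\<integral>\<^sup>+x. ennreal (std_normal_density x) * indicator {- sqrt d..sqrt d} x \<partial>lborel)
    = ennreal (lower_incomplete_gamma (d / 2) (1 / 2) / sqrt pi)"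
proof -
  define \<Phi> where "\<Phi> y = integral {0..y} std_normal_density" for y
  have cont: "continuous_on S std_normal_density" for S
    unfolding std_normal_density_def[abs_def] by (intro continuous_intros) auto
  have int: "std_normal_density integrable_on {a..b}" for a b
    by (rule integrable_continuous_interval[OF cont])
  have \<Phi>0: "\<Phi> 0 = 0" by (simp add: \<Phi>_def)
  have sym: "integral {- sqrt d..0} std_normal_density = \<Phi> (sqrt d)"
    unfolding \<Phi>_def
    using Henstock_Kurzweil_Integration.integral_reflect_real[of "sqrt d" 0 std_normal_density]
    by (simp add: normal_density_def[abs_def])
  have "integral {- sqrt d..sqrt d} std_normal_density = 2 * \<Phi> (sqrt d)"
    using Henstock_Kurzweil_Integration.integral_combine[OF _ _ int, of "- sqrt d" 0 "sqrt d"] sym assms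
    by (simp add: \<Phi>_def)
  then have I: "(std_normal_density has_integral 2 * \<Phi> (sqrt d)) {- sqrt d..sqrt d}"
    using int[of "- sqrt d" "sqrt d"] by (metis has_integral_integrable_integral)
  have "(\<integral>\<^sup>+x. ennreal (std_normal_density x) * indicator {- sqrt d..sqrt d} x \<partial>lborel)
      = ennreal (2 * \<Phi> (sqrt d))"
    by (rule nn_integral_has_integral_lebesgue'[OF _ I]) auto
  also have "2 * \<Phi> (sqrt d) = lower_incomplete_gamma (d / 2) (1 / 2) / sqrt pi"
  proof -
    have der: "(\<Phi> has_real_derivative std_normal_density y) (at y)" if "0 < y" for y
    proof -
      have "(\<Phi> has_real_derivative std_normal_density y) (at y within {0..y+1})"
        unfolding \<Phi>_def[abs_def] using that
        by (intro integral_has_real_derivative cont) auto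
      then show ?thesis using that
        by (simp add: at_within_interior[of y "{0..y+1}"])
    qed
    \<comment> \<open>One-sided continuity at 0 is included, where \<open>der\<close> says
      nothing.\<close>
    have cont\<Phi>: "continuous_on {0..} \<Phi>"
    proof -
      have "continuous_on {0..b} \<Phi>" for b
        unfolding \<Phi>_def[abs_def] by (rule indefinite_integral_continuous_1[OF int])
      then have "continuous (at x within {0..}) \<Phi>" if "x \<ge> 0" for x
      proof -
        assume c: "\<And>b. continuous_on {0..b} \<Phi>"
        have "continuous (at x within {0..x+1}) \<Phi>"
          using c[of "x+1"] that by (auto simp: continuous_on_eq_continuous_within)
        moreover have "at x within {0..x+1} = at x within {0..}"
          by (rule at_within_nhd[of _ "{..<x+1}"]) auto
        ultimately show ?thesis by simp
      qed
      then show ?thesis by (auto simp: continuous_on_eq_continuous_within)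
    qed
    \<comment> \<open>The substitution \<open>y = sqrt (2 * t)\<close> gives the antiderivative. The
      integrand is unbounded near 0, hence the version of the fundamental theorem that asks for
      derivatives in the interior only.\<close>
    have "((\<lambda>t. t powr (1/2 - 1) * exp (- t)) has_integral
        sqrt pi * (2 * \<Phi> (sqrt (2 * (d/2)))) - sqrt pi * (2 * \<Phi> (sqrt (2 * 0)))) {0..d/2}"
    proof (rule fundamental_theorem_of_calculus_interior)
      show "0 \<le> d / 2" using assms by simp
      show "continuous_on {0..d/2} (\<lambda>t. sqrt pi * (2 * \<Phi> (sqrt (2 * t))))"
        by (intro continuous_intros continuous_on_compose2[OF cont\<Phi>]) auto
      fix t assume t: "t \<in> {0<..<d/2}"
      have e: "exp (- (sqrt (2*t))\<^sup>2 / 2) = exp (-t)" using t by simp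
      have "((\<lambda>t. sqrt pi * (2 * \<Phi> (sqrt (2 * t)))) has_real_derivative
          sqrt pi * (2 * (std_normal_density (sqrt (2*t)) * (inverse (sqrt (2*t)) / 2 * 2)))) (at t)"
        using t by (auto intro!: derivative_eq_intros DERIV_chain2[of \<Phi>] der)
      also have "sqrt pi * (2 * (std_normal_density (sqrt (2*t)) * (inverse (sqrt (2*t)) / 2 * 2)))
          = t powr (1/2 - 1) * exp (- t)"
        using t unfolding std_normal_density_def e
        by (simp add: powr_minus powr_half_sqrt real_sqrt_mult field_simps)
      finally show "((\<lambda>t. sqrt pi * (2 * \<Phi> (sqrt (2 * t)))) has_vector_derivative
          t powr (1/2 - 1) * exp (- t)) (at t)"
        by (simp add: has_real_derivative_iff_has_vector_derivative)
    qed
    then show ?thesis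
      by (simp add: lower_incomplete_gamma_def integral_unique \<Phi>0)
  qed
  finally show ?thesis .
qed

text \<open>This chi-square probability is the factor that the theorem raises to the power
  \<open>m\<close>.\<close>

lemma std_gaussian_inner_sq_le:
  fixes w :: "real^'n"
  assumes "norm w = 1" "0 \<le> d"
  shows "emeasure std_gaussian_measure {v. (v \<bullet> w)\<^sup>2 \<le> d}
    = ennreal (lower_incomplete_gamma (d / 2) (1 / 2) / sqrt pi)"
proof -
  have "(v \<bullet> w)\<^sup>2 \<le> d \<longleftrightarrow> v \<bullet> w \<in> {- sqrt d..sqrt d}" for v
    using assms(2) by (metis abs_le_iff atLeastAtMost_iff minus_le_iff real_sqrt_abs real_sqrt_le_iff)
  then have "{v. (v \<bullet> w)\<^sup>2 \<le> d} = {v. v \<bullet> w \<in> {- sqrt d..sqrt d}}" by blast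
  then show ?thesis
    using assms std_gaussian_inner[of "{- sqrt d..sqrt d}" w] lower_incomplete_gamma_half by simp
qed

subsection \<open>Averaging over the rotations of a plane\<close>

text \<open>For orthonormal \<open>e\<close> and \<open>f\<close> this is the rotation by
  \<open>t\<close> in their plane. It is the identity plus a correction within the plane, so the
  orthogonal complement stays fixed and needs no basis.\<close>

definition plane_rotation :: "'a::euclidean_space \<Rightarrow> 'a \<Rightarrow> real \<Rightarrow> 'a \<Rightarrow> 'a" where
  "plane_rotation e f t v = v + ((cos t - 1) * (v \<bullet> e) - sin t * (v \<bullet> f)) *\<^sub>R e
     + (sin t * (v \<bullet> e) + (cos t - 1) * (v \<bullet> f)) *\<^sub>R f"

lemma plane_rotation_inner:
  assumes "e \<bullet> e = 1" "f \<bullet> f = 1" "e \<bullet> f = 0"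
  shows "plane_rotation e f t v \<bullet> e = cos t * (v \<bullet> e) - sin t * (v \<bullet> f)"
    and "plane_rotation e f t v \<bullet> f = sin t * (v \<bullet> e) + cos t * (v \<bullet> f)"
  using assms by (auto simp: plane_rotation_def inner_simps inner_commute[of f e] algebra_simps)

lemma plane_rotation_orthogonal:
  assumes ef: "e \<bullet> e = 1" "f \<bullet> f = 1" "e \<bullet> f = 0"
  shows "orthogonal_transformation (plane_rotation e f t)"
  unfolding orthogonal_transformation
proof (intro conjI allI)
  show "linear (plane_rotation e f t)"
    by (rule linearI) (auto simp: plane_rotation_def inner_simps algebra_simps scaleR_add_left)
  fix v
  define p q c s where "p = v \<bullet> e" "q = v \<bullet> f" "c = cos t" "s = sin t"
  note D = this
  have cs: "c\<^sup>2 + s\<^sup>2 = 1" by (simp add: D)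
  have "plane_rotation e f t v \<bullet> plane_rotation e f t v
     = v \<bullet> v + 2 * ((c - 1) * p - s * q) * p + 2 * (s * p + (c - 1) * q) * q
       + ((c - 1) * p - s * q)\<^sup>2 + (s * p + (c - 1) * q)\<^sup>2"
    using ef by (simp add: plane_rotation_def D[symmetric] inner_simps inner_commute[of f e]
        inner_commute[of e v] inner_commute[of f v] power2_eq_square algebra_simps)
  \<comment> \<open>The cross terms in \<open>p * q\<close> cancel, and the rest collects into a
    multiple of \<open>c\<^sup>2 + s\<^sup>2 - 1\<close>.\<close>
  also have "\<dots> = v \<bullet> v + (c\<^sup>2 + s\<^sup>2 - 1) * (p\<^sup>2 + q\<^sup>2)"
    by algebra
  finally show "norm (plane_rotation e f t v) = norm v"
    by (simp add: cs norm_eq_sqrt_inner)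
qed

text \<open>Moving the start of a window of length \<open>p\<close> trades a piece at one end for
  its translate by \<open>p\<close> at the other.\<close>

lemma nn_integral_period:
  fixes f :: "real \<Rightarrow> ennreal"
  assumes [measurable]: "f \<in> borel_measurable borel"
    and per: "\<And>x. f (x + p) = f x" and p: "0 < p"
  shows "(\<integral>\<^sup>+x. f (c + x) * indicator {0..<p} x \<partial>lborel) = (\<integral>\<^sup>+x. f x * indicator {d..<d + p} x \<partial>lborel)"
proof -
  define I where "I c = (\<integral>\<^sup>+x. f x * indicator {c..<c + p} x \<partial>lborel)" for c
  have shift: "(\<integral>\<^sup>+x. f (c + x) * indicator A (c + x) \<partial>lborel) = (\<integral>\<^sup>+x. f x * indicator A x \<partial>lborel)"
    if [measurable]: "A \<in> sets borel" for A c
    by (rule nn_integral_lborel_translate) measurable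
  have split: "(\<integral>\<^sup>+x. f x * indicator {a..<c} x \<partial>lborel)
      = (\<integral>\<^sup>+x. f x * indicator {a..<b} x \<partial>lborel) + (\<integral>\<^sup>+x. f x * indicator {b..<c} x \<partial>lborel)"
    if "a \<le> b" "b \<le> c" for a b c
    using that by (subst nn_integral_add[symmetric]) (auto intro!: nn_integral_cong simp: indicator_def)
  \<comment> \<open>Both windows contain \<open>{d..<c + p}\<close>, and the remaining pieces are
    translates by \<open>p\<close>. The additive form avoids subtracting possibly infinite
    values.\<close>
  have step: "I c = I d" if "c \<le> d" "d \<le> c + p" for c d
  proof -
    have "(\<integral>\<^sup>+x. f x * indicator {c..<d} x \<partial>lborel) = (\<integral>\<^sup>+x. f (p + x) * indicator {c + p..<d + p} (p + x) \<partial>lborel)"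
      using per by (auto intro!: nn_integral_cong simp: indicator_def add.commute)
    also have "\<dots> = (\<integral>\<^sup>+x. f x * indicator {c + p..<d + p} x \<partial>lborel)"
      by (rule shift) auto
    finally show ?thesis
      using that split[of c d "c + p"] split[of d "c + p" "d + p"] by (simp add: I_def add.commute)
  qed
  have far: "I c = I d" if "c \<le> d" "d \<le> c + real n * p" for c d n
    using that
  proof (induction n arbitrary: d)
    case 0
    then show ?case by simp
  next
    case (Suc n)
    show ?case
    proof (cases "d \<le> c + p")
      case True
      then show ?thesis using step Suc.prems by blast
    next
      case False
      then have "I c = I (d - p)"
        using Suc.prems p by (intro Suc.IH) (auto simp: algebra_simps)
      also have "\<dots> = I d" using p by (intro step) auto
      finally show ?thesis .
    qed
  qed
  have mono: "I c = I d" if "c \<le> d" for c d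
  proof -
    obtain n where "(d - c) / p \<le> real n" using real_arch_simple by blast
    then have "d \<le> c + real n * p" using p by (simp add: field_simps)
    then show ?thesis using far that by blast
  qed
  have "(\<integral>\<^sup>+x. f (c + x) * indicator {0..<p} x \<partial>lborel) = (\<integral>\<^sup>+x. f (c + x) * indicator {c..<c+p} (c + x) \<partial>lborel)"
    by (auto intro!: nn_integral_cong simp: indicator_def)
  also have "\<dots> = I c" unfolding I_def by (rule shift) auto
  also have "\<dots> = I d" by (metis linear mono)
  finally show ?thesis by (simp add: I_def)
qed

text \<open>Each rotation of the plane preserves the Gaussian measure, so Fubini turns the average
  over the angle into a constant. The angle is \<open>t / 2\<close> because squared inner products
  with vectors of the plane have period \<open>pi\<close> in the angle, hence \<open>2 * pi\<close>
  in \<open>t\<close>.\<close>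

lemma std_gaussian_rotation_average:
  fixes e f :: "real^'n"
  assumes ef: "e \<bullet> e = 1" "f \<bullet> f = 1" "e \<bullet> f = 0" and A[measurable]: "A \<in> sets borel"
  shows "ennreal (2 * pi) * emeasure std_gaussian_measure A
    = (\<integral>\<^sup>+v. \<integral>\<^sup>+t. indicator A (plane_rotation e f (t / 2) v) * indicator {0..<2 * pi} t \<partial>lborel \<partial>std_gaussian_measure)"
proof -
  interpret N: prob_space "std_gaussian_measure :: (real^'n) measure" by (rule prob_space_std_gaussian)
  interpret P: pair_sigma_finite lborel "std_gaussian_measure :: (real^'n) measure" ..
  have [measurable]: "(\<lambda>x. plane_rotation e f (fst x / 2) (snd x)) \<in> borel_measurable (lborel \<Otimes>\<^sub>M (std_gaussian_measure :: (real^'n) measure))"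
    unfolding plane_rotation_def by measurable
  have [measurable]: "(\<lambda>v. indicator A (plane_rotation e f t v) :: ennreal) \<in> borel_measurable borel" for t
    using orthogonal_transformation_measurable[OF plane_rotation_orthogonal[OF ef]] by measurable
  have inv: "(\<integral>\<^sup>+v. indicator A (plane_rotation e f t v) \<partial>std_gaussian_measure) = emeasure std_gaussian_measure A" for t
  proof -
    note o = plane_rotation_orthogonal[OF ef, of t]
    have [measurable]: "plane_rotation e f t \<in> borel_measurable borel"
      by (rule orthogonal_transformation_measurable[OF o])
    have "(\<integral>\<^sup>+v. indicator A (plane_rotation e f t v) \<partial>std_gaussian_measure)
        = (\<integral>\<^sup>+v. indicator A v \<partial>distr std_gaussian_measure borel (plane_rotation e f t))"
      by (subst nn_integral_distr) auto
    then show ?thesis by (simp add: std_gaussian_orthogonal[OF o])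
  qed
  have "(\<integral>\<^sup>+v. \<integral>\<^sup>+t. indicator A (plane_rotation e f (t / 2) v) * indicator {0..<2 * pi} t \<partial>lborel \<partial>std_gaussian_measure)
     = (\<integral>\<^sup>+t. \<integral>\<^sup>+v. indicator A (plane_rotation e f (t / 2) v) * indicator {0..<2 * pi} t \<partial>std_gaussian_measure \<partial>lborel)"
    by (rule P.Fubini') (use measurable_compose[OF _ borel_measurable_indicator] in measurable)
  also have "\<dots> = (\<integral>\<^sup>+t. emeasure std_gaussian_measure A * indicator {0..<2 * pi} t \<partial>lborel)"
    by (subst nn_integral_multc) (simp_all add: inv)
  also have "\<dots> = ennreal (2 * pi) * emeasure std_gaussian_measure A"
    by (simp add: nn_integral_cmult mult.commute)
  finally show ?thesis by simp
qed

section \<open>Comparison of arcs on one circle\<close>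

text \<open>\<open>c\<close> and \<open>t\<close> will be the angles in \<open>{0..pi}\<close> at
  which the squared inner product with \<open>xs\<close> equals \<open>d\<close> and
  \<open>T\<close>. The first bound keeps the part of the good arc below \<open>c\<close> inside
  \<open>\<bar>\<phi>\<bar> < c\<close>; the second compares the lengths of the bad and the good
  arc.\<close>

lemma arc_lengths:
  fixes \<theta> \<alpha> c t :: real
  assumes \<alpha>: "0 \<le> \<alpha>" "\<alpha> \<le> pi / 2" and \<theta>: "0 < \<theta>" "\<theta> < pi"
    and ct: "0 \<le> c" "c \<le> t" "t \<le> pi" and cos: "cos c - cos t = (sin \<alpha>)\<^sup>2 * sin \<theta>"
    and ne: "\<theta> + \<alpha> \<le> t"
  shows "\<bar>\<theta> - \<alpha>\<bar> \<le> c" and "t - c \<le> 2 * \<alpha>"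
proof -
  have s: "0 \<le> sin \<alpha>" "sin \<alpha> \<le> 1" "0 < sin \<theta>" "sin \<theta> \<le> 1"
    using \<alpha> \<theta> by (auto intro: sin_ge_zero sin_gt_zero)
  show "\<bar>\<theta> - \<alpha>\<bar> \<le> c"
  proof (rule ccontr)
    assume "\<not> ?thesis"
    then have "c < \<bar>\<theta> - \<alpha>\<bar>" "\<bar>\<theta> - \<alpha>\<bar> \<le> pi" using \<alpha> \<theta> by auto
    then have "cos \<bar>\<theta> - \<alpha>\<bar> < cos c" using ct by (intro cos_monotone_0_pi) auto
    moreover have "cos t \<le> cos (\<theta> + \<alpha>)"
      using ne \<alpha> \<theta> ct by (intro cos_monotone_0_pi_le) auto
    \<comment> \<open>The left-hand side is \<open>2 * sin \<alpha> * sin \<theta>\<close>, which is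
      at least the right-hand side since \<open>sin \<alpha> \<le> 1\<close>.\<close>
    ultimately have "cos (\<theta> - \<alpha>) - cos (\<theta> + \<alpha>) < (sin \<alpha>)\<^sup>2 * sin \<theta>"
      using cos unfolding cos_abs_real by linarith
    then have "2 * (sin \<alpha> * sin \<theta>) < sin \<alpha> * (sin \<alpha> * sin \<theta>)"
      by (simp add: cos_add cos_diff power2_eq_square algebra_simps)
    moreover have "sin \<alpha> * (sin \<alpha> * sin \<theta>) \<le> 2 * (sin \<alpha> * sin \<theta>)"
      using s(1,3) order_trans[OF s(2), of 2] by (intro mult_right_mono) auto
    ultimately show False by simp
  qed
  show "t - c \<le> 2 * \<alpha>"
  proof (rule ccontr)
    assume "\<not> ?thesis"
    then have l: "\<alpha> < (t - c) / 2" "(t - c) / 2 \<le> pi / 2" using ct by auto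
    then have "sin \<alpha> < sin ((t - c) / 2)" using \<alpha> by (intro sin_monotone_2pi) auto
    \<comment> \<open>Up to \<open>pi / 2\<close> this is monotonicity of the sine; beyond it,
      reflection at \<open>pi / 2\<close> applies, as \<open>t \<le> pi\<close>. It makes
      \<open>cos c - cos t\<close> exceed \<open>2 * (sin \<alpha>)\<^sup>2\<close>, contrary to its
      given value.\<close>
    moreover have "sin ((t - c) / 2) \<le> sin ((t + c) / 2)"
    proof (cases "(t + c) / 2 \<le> pi / 2")
      case True
      then show ?thesis using l \<alpha> ct by (intro sin_monotone_2pi_le) auto
    next
      case False
      have "(t - c) / 2 \<le> pi - (t + c) / 2" using ct by (simp add: field_simps)
      then have "sin ((t - c) / 2) \<le> sin (pi - (t + c) / 2)"
        using False l \<alpha> ct by (intro sin_monotone_2pi_le) auto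
      then show ?thesis by simp
    qed
    ultimately have "(sin \<alpha>)\<^sup>2 < sin ((t + c) / 2) * sin ((t - c) / 2)"
      unfolding power2_eq_square using s by (intro mult_strict_mono') auto
    moreover have "cos c - cos t = 2 * (sin ((t + c) / 2) * sin ((t - c) / 2))"
      by (simp add: cos_diff_cos add.commute)
    moreover have "(sin \<alpha>)\<^sup>2 * sin \<theta> \<le> (sin \<alpha>)\<^sup>2" using s by (simp add: mult_left_le)
    ultimately show False using cos zero_le_power2[of "sin \<alpha>"] by linarith
  qed
qed

text \<open>The angle \<open>\<phi>\<close> is twice the polar angle, measured from \<open>xs\<close>: then \<open>u \<phi>\<close> is the squared inner
  product with \<open>xs\<close> and \<open>u (\<phi> - 2 * \<theta>)\<close> the one with \<open>x\<close>. With \<open>\<alpha> = arcsin \<sigma>\<close>, each of the two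
  arcs of bad angles sits next to an arc \<open>\<bar>\<phi> - \<theta>\<bar> < \<alpha>\<close> or \<open>\<bar>\<phi> - \<theta> - pi\<bar> < \<alpha>\<close>, whose part with
  \<open>d < u \<phi>\<close> is at least as long. The reflection \<open>\<phi> \<mapsto> 2 * pi - \<phi>\<close>, \<open>\<theta> \<mapsto> pi - \<theta>\<close> exchanges the two
  situations.\<close>

lemma circle_comparison:
  fixes r d T \<theta> :: real
  defines "u \<equiv> \<lambda>\<phi>. r\<^sup>2 * (1 + cos \<phi>) / 2"
  defines "bad \<equiv> \<lambda>\<phi>. T \<le> u \<phi> \<and> u \<phi> \<le> d \<and> d < u (\<phi> - 2 * \<theta>)
      \<and> 2 * (d - T) * (sin \<theta> * r\<^sup>2) < (u \<phi> - u (\<phi> - 2 * \<theta>))\<^sup>2"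
  defines "good \<equiv> \<lambda>\<phi>. d < u \<phi> \<and> (u \<phi> - u (\<phi> - 2 * \<theta>))\<^sup>2 \<le> 2 * (d - T) * (sin \<theta> * r\<^sup>2)"
  assumes T: "0 < T" "T \<le> d" and \<theta>: "0 < \<theta>" "\<theta> < pi"
  shows "\<exists>w. emeasure lborel {\<phi>. w \<le> \<phi> \<and> \<phi> < w + 2 * pi \<and> bad \<phi>}
    \<le> emeasure lborel {\<phi>. w \<le> \<phi> \<and> \<phi> < w + 2 * pi \<and> good \<phi>}"
proof (cases "\<exists>\<phi>. bad \<phi>")
  case False
  then show ?thesis by simp
next
  case True
  then obtain \<phi>\<^sub>0 where bad0: "bad \<phi>\<^sub>0" ..
  have s: "0 < sin \<theta>" using \<theta> by (rule sin_gt_zero)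
  \<comment> \<open>The difference depends on \<open>\<phi>\<close> through
    \<open>sin (\<phi> - \<theta>)\<close> alone, so its size measures the distance of
    \<open>\<phi>\<close> from \<open>\<theta>\<close> modulo \<open>pi\<close>.\<close>
  have diff: "u \<phi> - u (\<phi> - 2 * \<theta>) = - (r\<^sup>2 * sin \<theta> * sin (\<phi> - \<theta>))" for \<phi>
  proof -
    have "cos \<phi> - cos (\<phi> - 2 * \<theta>) = cos ((\<phi> - \<theta>) + \<theta>) - cos ((\<phi> - \<theta>) - \<theta>)"
      by (simp add: algebra_simps)
    also have "\<dots> = - 2 * (sin \<theta> * sin (\<phi> - \<theta>))"
      unfolding cos_add cos_diff by (simp add: algebra_simps)
    finally have "r\<^sup>2 / 2 * (cos \<phi> - cos (\<phi> - 2 * \<theta>)) = r\<^sup>2 / 2 * (- 2 * (sin \<theta> * sin (\<phi> - \<theta>)))"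
      by simp
    then show ?thesis by (simp add: u_def field_simps)
  qed
  \<comment> \<open>Since \<open>u\<close> never exceeds \<open>r\<^sup>2\<close>, the bad angle
    forces \<open>d < r\<^sup>2\<close>, and the levels \<open>d\<close> and \<open>T\<close> are
    attained on the circle.\<close>
  have "u (\<phi>\<^sub>0 - 2 * \<theta>) \<le> r\<^sup>2 * (1 + 1) / 2"
    unfolding u_def by (intro divide_right_mono mult_left_mono add_left_mono) auto
  then have rd: "d < r\<^sup>2" and r: "0 < r\<^sup>2" using bad0 T by (auto simp: bad_def)
  \<comment> \<open>The threshold for \<open>\<bar>sin (\<phi> - \<theta>)\<bar>\<close>: by
    \<open>diff\<close>, \<open>\<sigma>\<^sup>2\<close> is the threshold for the squared difference
    divided by \<open>(r\<^sup>2 * sin \<theta>)\<^sup>2\<close>.\<close>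
  define \<sigma> where "\<sigma> = sqrt (2 * (d - T) / (sin \<theta> * r\<^sup>2))"
  have \<sigma>2: "\<sigma>\<^sup>2 = 2 * (d - T) / (sin \<theta> * r\<^sup>2)" and \<sigma>0: "0 \<le> \<sigma>"
    using T s r by (auto simp: \<sigma>_def)
  have \<sigma>2': "2 * (d - T) * (sin \<theta> * r\<^sup>2) = (r\<^sup>2 * sin \<theta>)\<^sup>2 * \<sigma>\<^sup>2"
  proof -
    have "x * q = q\<^sup>2 * (x / q)" if "0 < q" for x q :: real
      using that by (simp add: power2_eq_square)
    note this[of "sin \<theta> * r\<^sup>2" "2 * (d - T)"]
    moreover have "0 < sin \<theta> * r\<^sup>2" using s r by simp
    ultimately show ?thesis by (simp only: \<sigma>2 mult.commute[of "r\<^sup>2" "sin \<theta>"])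
  qed
  have fail: "2 * (d - T) * (sin \<theta> * r\<^sup>2) < (u \<phi> - u (\<phi> - 2 * \<theta>))\<^sup>2 \<longleftrightarrow> \<sigma> < \<bar>sin (\<phi> - \<theta>)\<bar>" for \<phi>
  proof -
    have "(u \<phi> - u (\<phi> - 2 * \<theta>))\<^sup>2 = (r\<^sup>2 * sin \<theta>)\<^sup>2 * (sin (\<phi> - \<theta>))\<^sup>2"
      by (simp add: diff power_mult_distrib)
    moreover have "\<sigma>\<^sup>2 < (sin (\<phi> - \<theta>))\<^sup>2 \<longleftrightarrow> \<sigma> < \<bar>sin (\<phi> - \<theta>)\<bar>"
      using \<sigma>0 by (metis abs_le_square_iff abs_of_nonneg not_le)
    ultimately show ?thesis using s r unfolding \<sigma>2' by simp
  qed
  have "\<sigma> < \<bar>sin (\<phi>\<^sub>0 - \<theta>)\<bar>" using bad0 fail by (simp add: bad_def)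
  then have \<sigma>1: "\<sigma> \<le> 1" using abs_sin_le_one[of "\<phi>\<^sub>0 - \<theta>"] by linarith
  define \<alpha> where "\<alpha> = arcsin \<sigma>"
  have \<alpha>: "0 \<le> \<alpha>" "\<alpha> \<le> pi / 2" and sin\<alpha>: "sin \<alpha> = \<sigma>"
    using \<sigma>0 \<sigma>1 arcsin_le_arcsin[of 0 \<sigma>] arcsin_ubound[of \<sigma>] by (auto simp: \<alpha>_def)
  define c where "c = arccos (2 * d / r\<^sup>2 - 1)"
  define t where "t = arccos (2 * T / r\<^sup>2 - 1)"
  have dr: "0 \<le> d / r\<^sup>2" "d / r\<^sup>2 \<le> 1" "0 \<le> T / r\<^sup>2" "T / r\<^sup>2 \<le> 1" "T / r\<^sup>2 \<le> d / r\<^sup>2"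
    using T rd r by (auto simp: divide_right_mono)
  have cosc: "cos c = 2 * d / r\<^sup>2 - 1" and cost: "cos t = 2 * T / r\<^sup>2 - 1"
    and ct: "0 \<le> c" "c \<le> t" "t \<le> pi" "c \<le> pi" "0 \<le> t"
    unfolding c_def t_def using dr
    by (auto intro!: cos_arccos arccos_lbound arccos_ubound arccos_le_arccos simp: times_divide_eq_right[symmetric] simp del: times_divide_eq_right)
  have dc: "d < u \<phi> \<longleftrightarrow> cos c < cos \<phi>" "u \<phi> \<le> d \<longleftrightarrow> cos \<phi> \<le> cos c" "T \<le> u \<phi> \<longleftrightarrow> cos t \<le> cos \<phi>" for \<phi>
    using r unfolding cosc cost u_def by (auto simp: field_simps)
  \<comment> \<open>Both sides equal \<open>2 * (d - T) / r\<^sup>2\<close>. This ties the arc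
    between the two levels to the half-width \<open>\<alpha>\<close>.\<close>
  have cos: "cos c - cos t = (sin \<alpha>)\<^sup>2 * sin \<theta>"
    using s r unfolding cosc cost sin\<alpha> \<sigma>2 by (simp add: field_simps)
  \<comment> \<open>\<open>I1\<close> and \<open>I2\<close> cover the bad angles of the window up to
    \<open>pi\<close> and beyond it; \<open>J1\<close> and \<open>J2\<close> consist of good angles.
    When the condition in \<open>J1\<close> or \<open>J2\<close> fails, the bad arc next to it is
    empty and \<open>arc_lengths\<close> does not apply.\<close>
  define I1 where "I1 = {max (\<theta> + \<alpha>) c..t}"
  define I2 where "I2 = {2 * pi - t..min (pi + \<theta> - \<alpha>) (2 * pi - c)}"
  define J1 where "J1 = (if \<theta> + \<alpha> \<le> t then {\<theta> - \<alpha><..<min (\<theta> + \<alpha>) c} else {})"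
  define J2 where "J2 = (if pi - \<theta> + \<alpha> \<le> t then {max (pi + \<theta> - \<alpha>) (2 * pi - c)<..<pi + \<theta> + \<alpha>} else {})"
  \<comment> \<open>The window of length \<open>2 * pi\<close> from here contains \<open>J1\<close>
    and \<open>J2\<close> unbroken, because \<open>\<alpha> \<le> pi / 2\<close>.\<close>
  define w where "w = \<theta> - \<alpha>"
  have [measurable]: "I1 \<in> sets borel" "I2 \<in> sets borel" "J1 \<in> sets borel" "J2 \<in> sets borel"
    by (auto simp: I1_def I2_def J1_def J2_def)
  have m1: "emeasure lborel I1 \<le> emeasure lborel J1"
  proof (cases "\<theta> + \<alpha> \<le> t")
    case True
    note arc_lengths[OF \<alpha> \<theta> ct(1-3) cos True]
    then show ?thesis
      using \<alpha> True by (auto simp: I1_def J1_def emeasure_lborel_Icc_eq intro!: ennreal_leI)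
  next
    case False
    then have "I1 = {}" by (auto simp: I1_def)
    then show ?thesis by simp
  qed
  have \<theta>': "0 < pi - \<theta>" "pi - \<theta> < pi" and cos': "cos c - cos t = (sin \<alpha>)\<^sup>2 * sin (pi - \<theta>)"
    using \<theta> cos by auto
  have m2: "emeasure lborel I2 \<le> emeasure lborel J2"
  proof (cases "pi - \<theta> + \<alpha> \<le> t")
    case True
    note arc_lengths[OF \<alpha> \<theta>' ct(1-3) cos' True]
    then show ?thesis
      using \<alpha> True by (auto simp: I2_def J2_def emeasure_lborel_Icc_eq intro!: ennreal_leI)
  next
    case False
    then have "I2 = {}" by (auto simp: I2_def)
    then show ?thesis by simp
  qed
  \<comment> \<open>At a bad angle \<open>u (\<phi> - 2 * \<theta>)\<close> exceeds
    \<open>u \<phi>\<close>, so the sine in \<open>diff\<close> is positive and even larger than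
    \<open>sin \<alpha>\<close>. This confines \<open>\<phi>\<close> to the open interval from
    \<open>\<theta> + \<alpha>\<close> to \<open>pi + \<theta> - \<alpha>\<close>. The levels
    \<open>T\<close> and \<open>d\<close> then put \<open>\<phi>\<close> or its reflection
    \<open>2 * pi - \<phi>\<close> into \<open>{c..t}\<close>.\<close>
  have badI: "{\<phi>. w \<le> \<phi> \<and> \<phi> < w + 2 * pi \<and> bad \<phi>} \<subseteq> I1 \<union> I2"
  proof
    fix \<phi> assume "\<phi> \<in> {\<phi>. w \<le> \<phi> \<and> \<phi> < w + 2 * pi \<and> bad \<phi>}"
    then have w: "\<theta> - \<alpha> \<le> \<phi>" "\<phi> < \<theta> - \<alpha> + 2 * pi" and b: "bad \<phi>" by (auto simp: w_def)
    have "u \<phi> - u (\<phi> - 2 * \<theta>) < 0" using b by (simp add: bad_def)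
    then have "0 < r\<^sup>2 * sin \<theta> * sin (\<phi> - \<theta>)" unfolding diff by simp
    then have pos: "0 < sin (\<phi> - \<theta>)" by (rule zero_less_mult_pos) (use s r in simp)
    have big: "sin \<alpha> < sin (\<phi> - \<theta>)" using b pos fail[of \<phi>] by (simp add: bad_def sin\<alpha>)
    have 1: "\<theta> < \<phi>"
    proof (rule ccontr)
      assume "\<not> ?thesis"
      then have "0 \<le> sin (- (\<phi> - \<theta>))" using w \<alpha> by (intro sin_ge_zero) auto
      then show False using pos by (simp only: sin_minus)
    qed
    have 2: "\<phi> - \<theta> < pi"
    proof (rule ccontr)
      assume "\<not> ?thesis"
      then have "0 \<le> sin (\<phi> - \<theta> - pi)" using w \<alpha> by (intro sin_ge_zero) auto
      then show False using pos by (simp add: sin_diff)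
    qed
    have 3: "\<theta> + \<alpha> < \<phi>"
    proof (rule ccontr)
      assume "\<not> ?thesis"
      then have "sin (\<phi> - \<theta>) \<le> sin \<alpha>" using 1 \<alpha> by (intro sin_monotone_2pi_le) auto
      then show False using big by simp
    qed
    have 4: "\<phi> < pi + \<theta> - \<alpha>"
    proof (rule ccontr)
      assume "\<not> ?thesis"
      then have "sin (pi - (\<phi> - \<theta>)) \<le> sin \<alpha>" using 2 \<alpha> by (intro sin_monotone_2pi_le) auto
      then show False using big by (simp only: sin_pi_minus)
    qed
    have cc: "cos t \<le> cos \<phi>" "cos \<phi> \<le> cos c" using b by (auto simp: bad_def dc)
    show "\<phi> \<in> I1 \<union> I2"
    proof (cases "\<phi> \<le> pi")
      case True
      then have "c \<le> \<phi>" "\<phi> \<le> t" using cc ct 1 \<theta> by (auto simp: cos_mono_le_eq)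
      then show ?thesis using 3 by (auto simp: I1_def)
    next
      case False
      have "cos (2 * pi - \<phi>) = cos \<phi>" by (simp add: cos_diff)
      moreover have "0 \<le> 2 * pi - \<phi>" "2 * pi - \<phi> \<le> pi" using False 4 \<theta> \<alpha> by auto
      ultimately have "c \<le> 2 * pi - \<phi>" "2 * pi - \<phi> \<le> t"
        using cc ct cos_mono_le_eq[of t "2 * pi - \<phi>"] cos_mono_le_eq[of "2 * pi - \<phi>" c] by auto
      then show ?thesis using 4 by (auto simp: I2_def)
    qed
  qed
  have small: "\<bar>sin y\<bar> \<le> \<sigma>" if "\<bar>y\<bar> \<le> \<alpha>" for y
  proof -
    have "- \<alpha> \<le> y" "y \<le> \<alpha>" using that by auto
    then have "sin y \<le> sin \<alpha>" "sin (- \<alpha>) \<le> sin y" using \<alpha> by (auto intro!: sin_monotone_2pi_le simp del: sin_minus)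
    then show ?thesis by (simp add: sin\<alpha> abs_le_iff)
  qed
  have far: "d < u \<phi>" if "\<bar>\<phi>\<bar> < c" for \<phi>
  proof -
    have "cos c < cos \<bar>\<phi>\<bar>" using that ct by (intro cos_monotone_0_pi) auto
    then show ?thesis by (simp add: dc)
  qed
  have J1: "J1 \<subseteq> {\<phi>. w \<le> \<phi> \<and> \<phi> < w + 2 * pi \<and> good \<phi>}"
  proof (cases "\<theta> + \<alpha> \<le> t")
    case True
    show ?thesis
    proof
      fix \<phi> assume "\<phi> \<in> J1"
      then have c: "\<theta> - \<alpha> < \<phi>" "\<phi> < \<theta> + \<alpha>" "\<phi> < c" using True by (auto simp: J1_def)
      moreover have "\<bar>sin (\<phi> - \<theta>)\<bar> \<le> \<sigma>" using c by (intro small) auto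
      moreover have "d < u \<phi>" using c arc_lengths(1)[OF \<alpha> \<theta> ct(1-3) cos True] by (intro far) auto
      ultimately show "\<phi> \<in> {\<phi>. w \<le> \<phi> \<and> \<phi> < w + 2 * pi \<and> good \<phi>}"
        using \<alpha> fail[of \<phi>] by (auto simp: good_def w_def not_less[symmetric])
    qed
  qed (simp add: J1_def)
  have J2: "J2 \<subseteq> {\<phi>. w \<le> \<phi> \<and> \<phi> < w + 2 * pi \<and> good \<phi>}"
  proof (cases "pi - \<theta> + \<alpha> \<le> t")
    case True
    show ?thesis
    proof
      fix \<phi> assume "\<phi> \<in> J2"
      then have c: "pi + \<theta> - \<alpha> < \<phi>" "\<phi> < pi + \<theta> + \<alpha>" "2 * pi - c < \<phi>" using True by (auto simp: J2_def)
      have "sin (\<phi> - \<theta> - pi) = - sin (\<phi> - \<theta>)" by (simp add: sin_diff[of _ pi])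
      moreover have "\<bar>sin (\<phi> - \<theta> - pi)\<bar> \<le> \<sigma>" using c by (intro small) auto
      moreover have "d < u (2 * pi - \<phi>)" using c arc_lengths(1)[OF \<alpha> \<theta>' ct(1-3) cos' True] by (intro far) auto
      moreover have "u (2 * pi - \<phi>) = u \<phi>" by (simp add: u_def cos_diff)
      ultimately show "\<phi> \<in> {\<phi>. w \<le> \<phi> \<and> \<phi> < w + 2 * pi \<and> good \<phi>}"
        using c \<alpha> fail[of \<phi>] by (auto simp: good_def w_def not_less[symmetric])
    qed
  qed (simp add: J2_def)
  have disj: "J1 \<inter> J2 = {}" using \<alpha> by (auto simp: J1_def J2_def)
  have [measurable]: "u \<in> borel_measurable borel" unfolding u_def by measurable
  have meas: "{\<phi>. w \<le> \<phi> \<and> \<phi> < w + 2 * pi \<and> good \<phi>} \<in> sets lborel"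
  proof -
    have "{\<phi> \<in> space borel. w \<le> \<phi> \<and> \<phi> < w + 2 * pi \<and> good \<phi>} \<in> sets borel"
      unfolding good_def by measurable
    then show ?thesis by simp
  qed
  have "emeasure lborel {\<phi>. w \<le> \<phi> \<and> \<phi> < w + 2 * pi \<and> bad \<phi>} \<le> emeasure lborel (I1 \<union> I2)"
    by (rule emeasure_mono[OF badI]) simp
  also have "\<dots> \<le> emeasure lborel I1 + emeasure lborel I2"
    by (rule emeasure_subadditive) auto
  also have "\<dots> \<le> emeasure lborel J1 + emeasure lborel J2"
    by (rule add_mono[OF m1 m2])
  also have "\<dots> = emeasure lborel (J1 \<union> J2)"
    by (rule plus_emeasure) (auto simp: disj)
  also have "\<dots> \<le> emeasure lborel {\<phi>. w \<le> \<phi> \<and> \<phi> < w + 2 * pi \<and> good \<phi>}"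
    by (rule emeasure_mono[OF _ meas]) (use J1 J2 in blast)
  finally show ?thesis by blast
qed

text \<open>In terms of the angle \<open>\<theta>\<close> and the length \<open>r\<close> of the
  projection to the plane, \<open>S v\<close> is \<open>sin \<theta> * r\<^sup>2\<close>. So the
  circle comparison applies to each \<open>v\<close> and is averaged over the rotations.\<close>

lemma std_gaussian_strip_comparison:
  fixes xs x :: "real^'n"
  defines "S \<equiv> \<lambda>v. ((v \<bullet> xs)\<^sup>2 + (v \<bullet> x)\<^sup>2 - 2 * (xs \<bullet> x) * (v \<bullet> xs) * (v \<bullet> x)) / sqrt (1 - (xs \<bullet> x)\<^sup>2)"
  assumes n: "norm xs = 1" "norm x = 1" and ne: "(xs \<bullet> x)\<^sup>2 < 1" and T: "0 < T" "T \<le> d"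
  shows "emeasure std_gaussian_measure {v. T \<le> (v \<bullet> xs)\<^sup>2 \<and> (v \<bullet> xs)\<^sup>2 \<le> d \<and> d < (v \<bullet> x)\<^sup>2
      \<and> 2 * (d - T) * S v < ((v \<bullet> xs)\<^sup>2 - (v \<bullet> x)\<^sup>2)\<^sup>2}
    \<le> emeasure std_gaussian_measure {v. d < (v \<bullet> xs)\<^sup>2
      \<and> ((v \<bullet> xs)\<^sup>2 - (v \<bullet> x)\<^sup>2)\<^sup>2 \<le> 2 * (d - T) * S v}"
    (is "emeasure _ ?B \<le> emeasure _ ?G")
proof -
  define \<theta> where "\<theta> = arccos (xs \<bullet> x)"
  have lt: "- 1 < xs \<bullet> x" "xs \<bullet> x < 1"
    using ne by (auto simp: abs_square_less_1 abs_less_iff)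
  have \<theta>: "0 < \<theta>" "\<theta> < pi" and cs: "xs \<bullet> x = cos \<theta>"
    using arccos_lt_bounded[OF lt] lt by (auto simp: \<theta>_def)
  have s: "0 < sin \<theta>" using \<theta> by (rule sin_gt_zero)
  have sq: "sqrt (1 - (cos \<theta>)\<^sup>2) = sin \<theta>" using s by (simp add: sin_squared_eq[symmetric])
  \<comment> \<open>Gram-Schmidt completes \<open>xs\<close> to an orthonormal basis of the
    plane.\<close>
  define f where "f = (1 / sin \<theta>) *\<^sub>R (x - cos \<theta> *\<^sub>R xs)"
  have nn: "xs \<bullet> xs = 1" "x \<bullet> x = 1" using n by (auto simp: norm_eq_1)
  have "f \<bullet> f = (1 - (cos \<theta>)\<^sup>2) / (sin \<theta>)\<^sup>2"
    using s by (simp add: f_def inner_simps nn cs inner_commute[of x xs] power2_eq_square field_simps)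
  then have ff: "f \<bullet> f = 1" using s by (simp add: sin_squared_eq[symmetric])
  have ef: "xs \<bullet> f = 0" by (simp add: f_def inner_simps nn cs)
  have x: "v \<bullet> x = cos \<theta> * (v \<bullet> xs) + sin \<theta> * (v \<bullet> f)" for v
    using s by (simp add: f_def inner_simps)
  have S: "S v = sin \<theta> * ((v \<bullet> xs)\<^sup>2 + (v \<bullet> f)\<^sup>2)" for v
  proof -
    define p q where "p = v \<bullet> xs" "q = v \<bullet> f"
    have "p\<^sup>2 + (cos \<theta> * p + sin \<theta> * q)\<^sup>2 - 2 * cos \<theta> * p * (cos \<theta> * p + sin \<theta> * q)
        = p\<^sup>2 * (1 - (cos \<theta>)\<^sup>2) + (sin \<theta>)\<^sup>2 * q\<^sup>2"
      by (simp add: power2_eq_square algebra_simps)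
    also have "\<dots> = (sin \<theta>)\<^sup>2 * (p\<^sup>2 + q\<^sup>2)"
      by (simp add: sin_squared_eq algebra_simps)
    finally show ?thesis
      using s unfolding S_def cs unfolding x sq p_q_def by (simp add: power2_eq_square)
  qed
  have [measurable]: "S \<in> borel_measurable borel" unfolding S_def by measurable
  have mB: "?B \<in> sets borel" and mG: "?G \<in> sets borel" by measurable
  have main: "(\<integral>\<^sup>+t. indicator ?B (plane_rotation xs f (t / 2) v) * indicator {0..<2 * pi} t \<partial>lborel)
     \<le> (\<integral>\<^sup>+t. indicator ?G (plane_rotation xs f (t / 2) v) * indicator {0..<2 * pi} t \<partial>lborel)" for v
  proof -
    \<comment> \<open>Polar coordinates in the plane: the rotation by \<open>t / 2\<close> takes the
      doubled angle \<open>2 * a\<close> to \<open>2 * a + t\<close>.\<close>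
    obtain r a where v: "v \<bullet> xs = r * cos a" "v \<bullet> f = r * sin a"
      using rcis_cmod_Arg[of "Complex (v \<bullet> xs) (v \<bullet> f)"] by (metis Im_rcis Re_rcis complex.sel)
    define u where "u \<phi> = r\<^sup>2 * (1 + cos \<phi>) / 2" for \<phi>
    define bad where "bad \<phi> \<longleftrightarrow> T \<le> u \<phi> \<and> u \<phi> \<le> d \<and> d < u (\<phi> - 2 * \<theta>)
      \<and> 2 * (d - T) * (sin \<theta> * r\<^sup>2) < (u \<phi> - u (\<phi> - 2 * \<theta>))\<^sup>2" for \<phi>
    define good where "good \<phi> \<longleftrightarrow> d < u \<phi>
      \<and> (u \<phi> - u (\<phi> - 2 * \<theta>))\<^sup>2 \<le> 2 * (d - T) * (sin \<theta> * r\<^sup>2)" for \<phi>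
    obtain w where w: "emeasure lborel {\<phi>. w \<le> \<phi> \<and> \<phi> < w + 2 * pi \<and> bad \<phi>}
        \<le> emeasure lborel {\<phi>. w \<le> \<phi> \<and> \<phi> < w + 2 * pi \<and> good \<phi>}"
      using circle_comparison[OF T \<theta>, of r] unfolding bad_def good_def u_def by blast
    have per: "u (\<phi> + 2 * pi) = u \<phi>" for \<phi> by (simp add: u_def)
    have per': "u (\<phi> + 2 * pi - 2 * \<theta>) = u (\<phi> - 2 * \<theta>)" for \<phi>
      using per[of "\<phi> - 2 * \<theta>"] by (simp add: algebra_simps)
    have [measurable]: "u \<in> borel_measurable borel" unfolding u_def by measurable
    have [measurable]: "Measurable.pred borel bad" "Measurable.pred borel good"
      unfolding bad_def[abs_def] good_def[abs_def] by measurable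
    \<comment> \<open>Periodicity moves the window \<open>{0..<2 * pi}\<close>, shifted by the phase
      \<open>2 * a\<close>, to the start \<open>w\<close> supplied by the circle comparison.\<close>
    have int: "(\<integral>\<^sup>+t. indicator {\<phi>. P \<phi>} (2 * a + t) * indicator {0..<2 * pi} t \<partial>lborel)
        = emeasure lborel {\<phi>. w \<le> \<phi> \<and> \<phi> < w + 2 * pi \<and> P \<phi>}"
      if [measurable]: "Measurable.pred borel P" and "\<And>\<phi>. P (\<phi> + 2 * pi) = P \<phi>" for P
    proof -
      have "(\<integral>\<^sup>+t. indicator {\<phi>. P \<phi>} (2 * a + t) * indicator {0..<2 * pi} t \<partial>lborel)
        = (\<integral>\<^sup>+t. indicator {\<phi>. P \<phi>} t * indicator {w..<w + 2 * pi} t \<partial>lborel)"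
        by (rule nn_integral_period) (use that(2) in \<open>auto simp: indicator_def\<close>)
      also have "\<dots> = (\<integral>\<^sup>+t. indicator {\<phi>. w \<le> \<phi> \<and> \<phi> < w + 2 * pi \<and> P \<phi>} t \<partial>lborel)"
        by (auto intro!: nn_integral_cong simp: indicator_def)
      also have "\<dots> = emeasure lborel {\<phi>. w \<le> \<phi> \<and> \<phi> < w + 2 * pi \<and> P \<phi>}"
        by (rule nn_integral_indicator) simp
      finally show ?thesis .
    qed
    have half: "(r * cos (b / 2))\<^sup>2 = u b" for b
      using cos_double_cos[of "b / 2"] by (simp add: u_def power_mult_distrib field_simps)
    have rot: "(plane_rotation xs f (t / 2) v \<bullet> xs)\<^sup>2 = u (2 * a + t)"
      "(plane_rotation xs f (t / 2) v \<bullet> x)\<^sup>2 = u (2 * a + t - 2 * \<theta>)"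
      "S (plane_rotation xs f (t / 2) v) = sin \<theta> * r\<^sup>2" for t
    proof -
      have 1: "plane_rotation xs f (t / 2) v \<bullet> xs = r * cos (a + t / 2)"
        "plane_rotation xs f (t / 2) v \<bullet> f = r * sin (a + t / 2)"
        by (simp_all add: plane_rotation_inner[OF nn(1) ff ef] v cos_add sin_add algebra_simps)
      have 2: "plane_rotation xs f (t / 2) v \<bullet> x = r * cos (a + t / 2 - \<theta>)"
        unfolding x 1 by (simp add: cos_diff algebra_simps)
      have "a + t / 2 = (2 * a + t) / 2" "a + t / 2 - \<theta> = (2 * a + t - 2 * \<theta>) / 2"
        by (simp_all add: field_simps)
      then show "(plane_rotation xs f (t / 2) v \<bullet> xs)\<^sup>2 = u (2 * a + t)"
        "(plane_rotation xs f (t / 2) v \<bullet> x)\<^sup>2 = u (2 * a + t - 2 * \<theta>)"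
        unfolding 1 2 by (simp_all only: half)
      have "r\<^sup>2 * (cos (a + t / 2))\<^sup>2 + r\<^sup>2 * (sin (a + t / 2))\<^sup>2 = r\<^sup>2"
        by (simp add: distrib_left[symmetric])
      then show "S (plane_rotation xs f (t / 2) v) = sin \<theta> * r\<^sup>2"
        unfolding S 1 power_mult_distrib by simp
    qed
    have "indicator ?B (plane_rotation xs f (t / 2) v) = (indicator {\<phi>. bad \<phi>} (2 * a + t) :: ennreal)"
      "indicator ?G (plane_rotation xs f (t / 2) v) = (indicator {\<phi>. good \<phi>} (2 * a + t) :: ennreal)" for t
      unfolding indicator_def mem_Collect_eq rot bad_def good_def by simp_all
    then show ?thesis
      using w by (simp add: int bad_def good_def per per')
  qed
  have "ennreal (2 * pi) * emeasure std_gaussian_measure ?B \<le> ennreal (2 * pi) * emeasure std_gaussian_measure ?G"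
    unfolding std_gaussian_rotation_average[OF nn(1) ff ef mB] std_gaussian_rotation_average[OF nn(1) ff ef mG]
    by (intro nn_integral_mono main)
  then show ?thesis
    by (simp add: ennreal_mult_le_mult_iff)
qed

subsection \<open>Deterministic bound for a single measurement\<close>

lemma neg_half_sq_ereal: "neg_half_sq (ereal r) = (if r \<le> 0 then r\<^sup>2 / 2 else 0)"
  by (simp add: neg_half_sq_def)

lemma neg_half_sq_nonneg: "0 \<le> neg_half_sq r"
  by (simp add: neg_half_sq_def)

text \<open>Factoring the difference of the squares leaves \<open>u - L\<close> times a sum of two
  terms, each at most \<open>S\<close>. Here \<open>L\<close> is the lower end of the cell of
  \<open>u\<close>, and \<open>v\<close> lies below the cell.\<close>

lemma sq_diff_below_bound:
  fixes u v w L S :: real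
  assumes "v \<le> L" "L \<le> u" "u - L \<le> w" "u - v \<le> S"
  shows "(u - v)\<^sup>2 / 2 - w * S \<le> (v - L)\<^sup>2 / 2"
proof -
  have "(u - v)\<^sup>2 - (v - L)\<^sup>2 = (u - L) * ((u - v) + (L - v))"
    by (simp add: power2_eq_square algebra_simps)
  also have "\<dots> \<le> w * (2 * S)"
    using assms by (intro mult_mono) auto
  finally show ?thesis by simp
qed

section \<open>The cells of the quantizer\<close>

context
  fixes k :: nat and \<tau> :: "nat \<Rightarrow> ereal" and s :: "nat \<Rightarrow> real"
  assumes Q: "is_quantizer k \<tau> s"
begin

lemma thresholds_strict: "i < j \<Longrightarrow> j \<le> k \<Longrightarrow> \<tau> i < \<tau> j"
proof (induction j)
  case (Suc j)
  have "\<tau> j < \<tau> (Suc j)" using Q Suc.prems by (force simp: is_quantizer_def)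
  then show ?case using Suc by (cases "i = j") auto
qed simp

lemma thresholds_mono: "i \<le> j \<Longrightarrow> j \<le> k \<Longrightarrow> \<tau> i \<le> \<tau> j"
  using thresholds_strict[of i j] by (cases "i = j") auto

lemma threshold_real: "j < k \<Longrightarrow> ereal (real_of_ereal (\<tau> j)) = \<tau> j"
  using thresholds_strict[of j k] thresholds_mono[of 0 j] Q
  by (cases "\<tau> j") (auto simp: is_quantizer_def)

lemma cell_unique:
  assumes "i \<in> {1..k}" "\<tau> (i - 1) \<le> x" "x < \<tau> i" "j \<in> {1..k}" "\<tau> (j - 1) \<le> x" "x < \<tau> j"
  shows "i = j"
proof (rule ccontr)
  assume "i \<noteq> j"
  then consider "i < j" | "j < i" by linarith
  then show False
  proof cases
    case 1
    then have "\<tau> i \<le> \<tau> (j - 1)" using assms by (intro thresholds_mono) auto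
    then show False using assms by auto
  next
    case 2
    then have "\<tau> j \<le> \<tau> (i - 1)" using assms by (intro thresholds_mono) auto
    then show False using assms by auto
  qed
qed

lemma cell_exists:
  assumes "0 \<le> u"
  obtains j where "j \<in> {1..k}" "\<tau> (j - 1) \<le> ereal u" "ereal u < \<tau> j"
proof -
  \<comment> \<open>The first threshold above \<open>u\<close>, with \<open>j \<noteq> 0\<close>
    because \<open>\<tau> 0 = 0\<close>; minimality gives the lower end of the cell.\<close>
  define j where "j = (LEAST j. ereal u < \<tau> j)"
  have k: "ereal u < \<tau> k" "\<tau> 0 = 0" using Q by (auto simp: is_quantizer_def)
  have j: "ereal u < \<tau> j" "j \<le> k"
    unfolding j_def using k(1) by (auto intro: LeastI Least_le)
  have "j \<noteq> 0" using j assms k by (metis ereal_less_eq(5) leD)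
  moreover from this have "\<not> ereal u < \<tau> (j - 1)"
    unfolding j_def by (intro not_less_Least) auto
  ultimately show ?thesis using j that[of j] by auto
qed

text \<open>Each symbol lies in its own cell, so the symbols are distinct and the measurement
  determines the cell of \<open>u\<close>.\<close>

lemma quantize_cell:
  assumes "j \<in> {1..k}" "\<tau> (j - 1) \<le> ereal u" "ereal u < \<tau> j"
  shows "symbol_index k s (quantize k \<tau> s u) = j"
proof -
  have cell: "\<tau> (i - 1) \<le> ereal (s i) \<and> ereal (s i) < \<tau> i" if "i \<in> {1..k}" for i
    using Q that unfolding is_quantizer_def by (meson less_imp_le)
  have "quantize k \<tau> s u = s j"
    unfolding quantize_def
    using assms by (intro arg_cong[of _ _ s] the_equality) (auto intro: cell_unique)
  moreover have "i = j" if "i \<in> {1..k}" "s j = s i" for i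
    using cell[OF that(1)] cell[OF assms(1)] cell_unique[of i "ereal (s i)" j] assms that by auto
  ultimately show ?thesis
    using assms(1) unfolding symbol_index_def by (metis (mono_tags, lifting) the_equality)
qed

lemma precision_ge:
  assumes "j \<in> {1..k - 1}"
  shows "real_of_ereal (\<tau> j) - real_of_ereal (\<tau> (j - 1)) \<le> precision k \<tau>"
  unfolding precision_def using assms by (intro Max_ge) auto

lemma precision_nonneg: "0 \<le> precision k \<tau>"
proof -
  have k: "k \<ge> 2" using Q by (simp add: is_quantizer_def)
  have "\<tau> 0 < \<tau> 1" using k by (intro thresholds_strict) auto
  moreover have "ereal (real_of_ereal (\<tau> 0)) = \<tau> 0" "ereal (real_of_ereal (\<tau> 1)) = \<tau> 1"
    using k by (simp_all add: threshold_real)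
  ultimately have "real_of_ereal (\<tau> 0) < real_of_ereal (\<tau> 1)"
    by (metis ereal_less(1) less_ereal.simps(1))
  moreover have "real_of_ereal (\<tau> 1) - real_of_ereal (\<tau> (1 - 1)) \<le> precision k \<tau>"
    using k by (intro precision_ge) auto
  ultimately show ?thesis by simp
qed

lemma last_threshold_pos: "0 < real_of_ereal (\<tau> (k - 1))"
proof -
  have k: "k \<ge> 2" "\<tau> 0 = 0" using Q by (auto simp: is_quantizer_def)
  then have "\<tau> 0 < \<tau> (k - 1)" by (intro thresholds_strict) auto
  moreover have "ereal (real_of_ereal (\<tau> (k - 1))) = \<tau> (k - 1)"
    using k by (intro threshold_real) simp
  ultimately show ?thesis using k by (metis ereal_less(2))
qed

text \<open>The cost grows with the distance of \<open>v\<close> from the cell, which falls short of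
  \<open>\<bar>u - v\<bar>\<close> by at most the width of a bounded cell. In the unbounded last
  cell a large \<open>v\<close> costs nothing; there \<open>ok\<close> either supplies
  \<open>d\<^sub>0 - T\<close> as a substitute for the width or bounds the squared difference
  directly.\<close>

lemma cell_cost_ge:
  fixes u v S C d\<^sub>0 :: real
  defines "T \<equiv> real_of_ereal (\<tau> (k - 1))"
  assumes j: "j \<in> {1..k}" "\<tau> (j - 1) \<le> ereal u" "ereal u < \<tau> j"
    and d: "T \<le> d\<^sub>0" and S: "\<bar>u - v\<bar> \<le> S" and C: "0 \<le> C"
    and ok: "u < T \<or> u \<le> d\<^sub>0 \<and> v \<le> d\<^sub>0 \<or> (u - v)\<^sup>2 \<le> 2 * (d\<^sub>0 - T) * S"
  shows "(u - v)\<^sup>2 / 2 - max (precision k \<tau>) (d\<^sub>0 - T) * S - C / 2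
    \<le> neg_half_sq (\<tau> j - ereal v) + neg_half_sq (ereal v - \<tau> (j - 1))"
proof -
  define w where "w = max (precision k \<tau>) (d\<^sub>0 - T)"
  define L where "L = real_of_ereal (\<tau> (j - 1))"
  have L: "\<tau> (j - 1) = ereal L"
    unfolding L_def using j by (intro threshold_real[symmetric]) auto
  then have Lu: "L \<le> u" using j by simp
  have w: "0 \<le> w" "d\<^sub>0 - T \<le> w" "precision k \<tau> \<le> w" using d by (auto simp: w_def)
  have S0: "0 \<le> S" using S by linarith
  \<comment> \<open>The costs are nonnegative, so it suffices that the lower bound is not
    positive.\<close>
  have easy: ?thesis if "(u - v)\<^sup>2 \<le> 2 * (w * S)"
    using that C neg_half_sq_nonneg[of "\<tau> j - ereal v"] neg_half_sq_nonneg[of "ereal v - \<tau> (j - 1)"]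
    by (simp add: w_def[symmetric])
  \<comment> \<open>One factor of \<open>(u - v)\<^sup>2\<close> is bounded by \<open>w\<close>, the
    other by \<open>S\<close>.\<close>
  have near: ?thesis if "\<bar>u - v\<bar> \<le> w"
  proof (rule easy)
    have "\<bar>u - v\<bar> * \<bar>u - v\<bar> \<le> w * S" using that S w by (intro mult_mono) auto
    then show "(u - v)\<^sup>2 \<le> 2 * (w * S)"
      using mult_nonneg_nonneg[OF w(1) S0] by (simp add: power2_eq_square abs_mult_self_eq)
  qed
  have below: ?thesis if "v < L" "u - L \<le> w"
  proof -
    have "(u - v)\<^sup>2 / 2 - w * S \<le> (v - L)\<^sup>2 / 2"
      using that Lu S by (intro sq_diff_below_bound) auto
    moreover have "neg_half_sq (ereal v - \<tau> (j - 1)) = (v - L)\<^sup>2 / 2"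
      unfolding L using that by (simp add: neg_half_sq_ereal)
    ultimately show ?thesis
      using C neg_half_sq_nonneg[of "\<tau> j - ereal v"] by (simp add: w_def[symmetric])
  qed
  show ?thesis
  proof (cases "j = k")
    case True
    have "T = L" by (simp add: T_def L_def True)
    \<comment> \<open>In the last cell \<open>T = L \<le> u\<close> rules out the alternative
      \<open>u < T\<close>.\<close>
    then consider "(u - v)\<^sup>2 \<le> 2 * (d\<^sub>0 - T) * S" | "u \<le> d\<^sub>0" "v \<le> d\<^sub>0"
      using ok Lu by linarith
    then show ?thesis
    proof cases
      case 1
      have "(d\<^sub>0 - T) * S \<le> w * S" using w S0 by (intro mult_right_mono) auto
      then have "2 * ((d\<^sub>0 - T) * S) \<le> 2 * (w * S)" by linarith
      then have "(u - v)\<^sup>2 \<le> 2 * (w * S)" using 1 unfolding mult.assoc by (rule order_trans[rotated])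
      then show ?thesis by (rule easy)
    next
      case 2
      then show ?thesis
        using near below Lu w \<open>T = L\<close> by (cases "v < L") auto
    qed
  next
    case False
    define U where "U = real_of_ereal (\<tau> j)"
    have U: "\<tau> j = ereal U"
      unfolding U_def using j False by (intro threshold_real[symmetric]) auto
    have Uu: "u < U" using j unfolding U by simp
    have "U - L \<le> precision k \<tau>"
      unfolding U_def L_def using j False by (intro precision_ge) auto
    then have UL: "U - L \<le> w" using w by simp
    consider "v < L" | "U < v" | "L \<le> v" "v \<le> U" by linarith
    then show ?thesis
    proof cases
      case 1
      then show ?thesis using below Uu UL by auto
    next
      case 2
      \<comment> \<open>Negation turns the upper end \<open>U\<close> of the cell into a lower
        end.\<close>
      have "(- u - - v)\<^sup>2 / 2 - w * S \<le> (- v - - U)\<^sup>2 / 2"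
        using 2 Lu Uu UL S by (intro sq_diff_below_bound) auto
      moreover have "neg_half_sq (\<tau> j - ereal v) = (U - v)\<^sup>2 / 2"
        unfolding U using 2 by (simp add: neg_half_sq_ereal)
      ultimately show ?thesis
        using C neg_half_sq_nonneg[of "ereal v - \<tau> (j - 1)"]
        by (simp add: w_def[symmetric] power2_commute[of u v])
    next
      case 3
      then show ?thesis using near Lu Uu UL by auto
    qed
  qed
qed

end

subsection \<open>The plane of the two signals\<close>

lemma outer_mult_vec: "outer v *v a = (v \<bullet> a) *\<^sub>R v"
  by (simp add: vec_eq_iff outer_def matrix_vector_mult_def inner_vec_def sum_distrib_left
      sum_distrib_right mult_ac)

lemma trace_outer: "trace (outer v) = v \<bullet> v"
  by (simp add: trace_def outer_def inner_vec_def)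

lemma trace_outer_mult: "trace (outer v ** outer w) = (v \<bullet> w)\<^sup>2"
  by (simp add: trace_def outer_def matrix_matrix_mult_def inner_vec_def power2_eq_square
      sum_product mult_ac)

lemma trace_orthogonal_conj:
  fixes R B :: "real^'n^'n"
  assumes "orthogonal_matrix R"
  shows "trace (R ** B ** transpose R) = trace B"
proof -
  have "trace (R ** B ** transpose R) = trace (transpose R ** (R ** B))"
    by (rule trace_mul_sym)
  then show ?thesis
    using assms by (simp add: matrix_mul_assoc orthogonal_matrix_def)
qed

text \<open>The matrix \<open>A = outer xs - outer x\<close> has trace 0 and \<open>A ** A\<close>
  has trace \<open>2 - 2 * \<rho>\<^sup>2\<close>, so the diagonal entries of \<open>D\<close> at
  \<open>p\<close> and \<open>q\<close> are opposite, with square \<open>1 - \<rho>\<^sup>2\<close>.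
  The first identity evaluates \<open>a \<bullet> (A *v a)\<close> in the eigenbasis, squared
  because the sign at \<open>p\<close> is open; the second evaluates the squared norm of
  \<open>A *v a\<close>.\<close>

lemma outer_diff_plane_coordinates:
  fixes xs x a :: "real^'n"
  defines "\<rho> \<equiv> xs \<bullet> x"
  assumes n: "norm xs = 1" "norm x = 1"
    and sd: "spectral_decomposition p q R D (outer xs - outer x)"
  defines "b \<equiv> transpose R *v a"
  shows "((a \<bullet> xs)\<^sup>2 - (a \<bullet> x)\<^sup>2)\<^sup>2 = (1 - \<rho>\<^sup>2) * ((b $ p)\<^sup>2 - (b $ q)\<^sup>2)\<^sup>2"
    and "(a \<bullet> xs)\<^sup>2 + (a \<bullet> x)\<^sup>2 - 2 * \<rho> * (a \<bullet> xs) * (a \<bullet> x) = (1 - \<rho>\<^sup>2) * ((b $ p)\<^sup>2 + (b $ q)\<^sup>2)"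
proof -
  define A where "A = outer xs - outer x"
  have pq: "p \<noteq> q" and R: "orthogonal_matrix R" and D: "\<And>i j. i \<noteq> j \<Longrightarrow> D $ i $ j = 0"
    and A: "A = R ** D ** transpose R" and D0: "\<And>i. i \<notin> {p, q} \<Longrightarrow> D $ i $ i = 0"
    using sd by (auto simp: spectral_decomposition_def A_def)
  have nn: "xs \<bullet> xs = 1" "x \<bullet> x = 1" using n by (auto simp: norm_eq_1)
  have two: "(\<Sum>i\<in>UNIV. D $ i $ i * g i) = D $ p $ p * g p + D $ q $ q * g q" for g :: "'n \<Rightarrow> real"
  proof -
    have "(\<Sum>i\<in>UNIV. D $ i $ i * g i) = (\<Sum>i\<in>{p, q}. D $ i $ i * g i)"
      by (rule sum.mono_neutral_right) (auto simp: D0)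
    then show ?thesis using pq by simp
  qed
  have diag: "(\<Sum>j\<in>UNIV. D $ i $ j * g j) = D $ i $ i * g i" for g :: "'n \<Rightarrow> real" and i
  proof -
    have "(\<Sum>j\<in>UNIV. D $ i $ j * g j) = (\<Sum>j\<in>{i}. D $ i $ j * g j)"
      by (rule sum.mono_neutral_right) (auto simp: D)
    then show ?thesis by simp
  qed
  have Av: "A *v v = (v \<bullet> xs) *\<^sub>R xs - (v \<bullet> x) *\<^sub>R x" for v
    by (simp add: A_def matrix_vector_mult_diff_rdistrib outer_mult_vec inner_commute)
  have orth: "orthogonal_transformation ((*v) R)"
    using R by (simp add: orthogonal_transformation_matrix matrix_vector_mul_linear)
  have Db: "(D *v b) $ i = D $ i $ i * b $ i" for i
    by (simp add: matrix_vector_mult_def diag)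
  have Aa: "A *v a = R *v (D *v b)"
    by (simp only: A b_def matrix_vector_mul_assoc matrix_mul_assoc)
  have "trace A = 0" by (simp add: A_def trace_sub trace_outer nn)
  moreover have "trace A = D $ p $ p + D $ q $ q"
    unfolding A trace_orthogonal_conj[OF R] using two[of "\<lambda>_. 1"] by (simp add: trace_def)
  ultimately have Dq: "D $ q $ q = - D $ p $ p" by simp
  have "A ** A = outer xs ** outer xs - outer xs ** outer x - (outer x ** outer xs - outer x ** outer x)"
    by (simp add: A_def vec_eq_iff matrix_matrix_mult_def left_diff_distrib right_diff_distrib
        sum_subtractf)
  then have "trace (A ** A) = 2 - 2 * \<rho>\<^sup>2"
    by (simp add: trace_sub trace_outer_mult nn \<rho>_def inner_commute[of x xs])
  moreover have "A ** A = R ** (D ** D) ** transpose R"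
  proof -
    have "A ** A = R ** D ** (transpose R ** R) ** D ** transpose R"
      unfolding A by (simp add: matrix_mul_assoc)
    moreover have "transpose R ** R = mat 1" using R by (simp add: orthogonal_matrix_def)
    ultimately show ?thesis by (simp add: matrix_mul_assoc[symmetric])
  qed
  moreover have "trace (D ** D) = (D $ p $ p)\<^sup>2 + (D $ q $ q)\<^sup>2"
    using two[of "\<lambda>i. D $ i $ i"] by (simp add: trace_def matrix_matrix_mult_def diag power2_eq_square)
  ultimately have Dp: "(D $ p $ p)\<^sup>2 = 1 - \<rho>\<^sup>2"
    by (simp add: trace_orthogonal_conj[OF R] Dq)
  have "(a \<bullet> xs)\<^sup>2 - (a \<bullet> x)\<^sup>2 = a \<bullet> (A *v a)"
    by (simp add: Av inner_simps power2_eq_square)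
  also have "\<dots> = b \<bullet> (D *v b)"
    unfolding Aa b_def transpose_matrix_vector by (simp add: dot_lmul_matrix)
  also have "\<dots> = D $ p $ p * ((b $ p)\<^sup>2 - (b $ q)\<^sup>2)"
    using two[of "\<lambda>i. (b $ i)\<^sup>2"]
    by (simp add: inner_vec_def Db Dq power2_eq_square algebra_simps)
  finally show "((a \<bullet> xs)\<^sup>2 - (a \<bullet> x)\<^sup>2)\<^sup>2 = (1 - \<rho>\<^sup>2) * ((b $ p)\<^sup>2 - (b $ q)\<^sup>2)\<^sup>2"
    by (simp add: power_mult_distrib Dp)
  have "(a \<bullet> xs)\<^sup>2 + (a \<bullet> x)\<^sup>2 - 2 * \<rho> * (a \<bullet> xs) * (a \<bullet> x) = (A *v a) \<bullet> (A *v a)"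
    by (simp add: Av inner_simps nn \<rho>_def inner_commute[of x xs] power2_eq_square algebra_simps)
  also have "\<dots> = (D *v b) \<bullet> (D *v b)"
    using orth unfolding Aa orthogonal_transformation_def by blast
  also have "\<dots> = (D $ p $ p)\<^sup>2 * ((b $ p)\<^sup>2 + (b $ q)\<^sup>2)"
    using two[of "\<lambda>i. D $ i $ i * (b $ i)\<^sup>2"]
    by (simp add: inner_vec_def Db Dq power2_eq_square algebra_simps)
  finally show "(a \<bullet> xs)\<^sup>2 + (a \<bullet> x)\<^sup>2 - 2 * \<rho> * (a \<bullet> xs) * (a \<bullet> x) = (1 - \<rho>\<^sup>2) * ((b $ p)\<^sup>2 + (b $ q)\<^sup>2)"
    by (simp add: Dp)
qed

section \<open>The cost of one sample as a measurable function\<close>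

lemma matrix_vector_component_measurable:
  fixes A :: "real^'n^'m"
  shows "(\<lambda>v. (A *v v) $ i) \<in> borel_measurable borel"
  by (intro borel_measurable_continuous_onI continuous_intros
      linear_continuous_on[OF matrix_vector_mul_bounded_linear])

text \<open>Summing over all cells avoids the definite descriptions in \<open>quantize\<close> and
  \<open>symbol_index\<close>, so measurability can be read off the expression.\<close>

definition cell_cost :: "nat \<Rightarrow> (nat \<Rightarrow> ereal) \<Rightarrow> real \<Rightarrow> real \<Rightarrow> real" where
  "cell_cost k \<tau> u v = (\<Sum>j=1..k. if \<tau> (j - 1) \<le> ereal u \<and> ereal u < \<tau> j
     then neg_half_sq (\<tau> j - ereal v) + neg_half_sq (ereal v - \<tau> (j - 1)) else 0)"

lemma neg_half_sq_measurable [measurable]: "neg_half_sq \<in> borel_measurable borel"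
  unfolding neg_half_sq_def[abs_def] by measurable

lemma cell_cost_measurable [measurable]:
  assumes [measurable]: "f \<in> borel_measurable M" "g \<in> borel_measurable M"
  shows "(\<lambda>\<omega>. cell_cost k \<tau> (f \<omega>) (g \<omega>)) \<in> borel_measurable M"
  unfolding cell_cost_def by measurable

lemma cell_cost_cell:
  assumes Q: "is_quantizer k \<tau> s" and j: "j \<in> {1..k}" "\<tau> (j - 1) \<le> ereal u" "ereal u < \<tau> j"
  shows "cell_cost k \<tau> u v = neg_half_sq (\<tau> j - ereal v) + neg_half_sq (ereal v - \<tau> (j - 1))"
proof -
  have "cell_cost k \<tau> u v = (\<Sum>i=1..k. if i = j
     then neg_half_sq (\<tau> j - ereal v) + neg_half_sq (ereal v - \<tau> (j - 1)) else 0)"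
    unfolding cell_cost_def
  proof (rule sum.cong[OF refl])
    fix i assume "i \<in> {1..k}"
    then have "\<tau> (i - 1) \<le> ereal u \<and> ereal u < \<tau> i \<longleftrightarrow> i = j"
      using cell_unique[OF Q _ _ _ j] j by blast
    then show "(if \<tau> (i - 1) \<le> ereal u \<and> ereal u < \<tau> i
        then neg_half_sq (\<tau> i - ereal v) + neg_half_sq (ereal v - \<tau> (i - 1)) else 0)
      = (if i = j then neg_half_sq (\<tau> j - ereal v) + neg_half_sq (ereal v - \<tau> (j - 1)) else 0)"
      by (auto split: if_splits)
  qed
  then show ?thesis using j by simp
qed

lemma cost_eq_cell_cost:
  assumes Q: "is_quantizer k \<tau> s"
  shows "cost k \<tau> s m a (\<lambda>i. quantize k \<tau> s (\<bar>a i \<bullet> xs\<bar>\<^sup>2)) (outer x)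
    = (\<Sum>i=1..m. cell_cost k \<tau> ((a i \<bullet> xs)\<^sup>2) ((a i \<bullet> x)\<^sup>2))"
  unfolding cost_def
proof (rule sum.cong[OF refl])
  fix i
  obtain j where j: "j \<in> {1..k}" "\<tau> (j - 1) \<le> ereal ((a i \<bullet> xs)\<^sup>2)" "ereal ((a i \<bullet> xs)\<^sup>2) < \<tau> j"
    using cell_exists[OF Q, of "(a i \<bullet> xs)\<^sup>2"] by auto
  show "(let j = symbol_index k s (quantize k \<tau> s (\<bar>a i \<bullet> xs\<bar>\<^sup>2)); t = ereal (trace (outer (a i) ** outer x))
      in neg_half_sq (\<tau> j - t) + neg_half_sq (t - \<tau> (j - 1))) = cell_cost k \<tau> ((a i \<bullet> xs)\<^sup>2) ((a i \<bullet> x)\<^sup>2)"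
    by (simp only: power2_abs quantize_cell[OF Q j] cell_cost_cell[OF Q j] trace_outer_mult Let_def)
qed

section \<open>Probability of the bound for one sample\<close>

text \<open>The part of \<open>?H\<close> where the bound fails lies in \<open>Bd\<close>. Its loss
  is made up by \<open>Gd\<close>, where the bound holds and which lies outside
  \<open>?H\<close>.\<close>

lemma sample_bound_probability:
  fixes xs x :: "real^'n" and R D :: "real^'n^'n"
  defines "b \<equiv> \<lambda>a. transpose R *v a"
  assumes Q: "is_quantizer k \<tau> s" and n: "norm xs = 1" "norm x = 1"
    and sd: "spectral_decomposition p q R D (outer xs - outer x)"
    and d: "real_of_ereal (\<tau> (k - 1)) \<le> d\<^sub>0" and C: "0 \<le> C"
  shows "emeasure std_gaussian_measure {a. (a \<bullet> xs)\<^sup>2 \<le> d\<^sub>0}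
    \<le> emeasure std_gaussian_measure {a. (1 - (xs \<bullet> x)\<^sup>2) / 2 * ((b a $ p)\<^sup>2 - (b a $ q)\<^sup>2)\<^sup>2
      - sqrt (1 - (xs \<bullet> x)\<^sup>2) * max (precision k \<tau>) (d\<^sub>0 - real_of_ereal (\<tau> (k - 1)))
          * ((b a $ p)\<^sup>2 + (b a $ q)\<^sup>2) - C / 2
      \<le> cell_cost k \<tau> ((a \<bullet> xs)\<^sup>2) ((a \<bullet> x)\<^sup>2)}"
    (is "emeasure ?N ?H \<le> emeasure ?N ?G")
proof -
  define low where "low a = (1 - (xs \<bullet> x)\<^sup>2) / 2 * ((b a $ p)\<^sup>2 - (b a $ q)\<^sup>2)\<^sup>2
      - sqrt (1 - (xs \<bullet> x)\<^sup>2) * max (precision k \<tau>) (d\<^sub>0 - real_of_ereal (\<tau> (k - 1)))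
          * ((b a $ p)\<^sup>2 + (b a $ q)\<^sup>2) - C / 2" for a
  define G where "G = {a. low a \<le> cell_cost k \<tau> ((a \<bullet> xs)\<^sup>2) ((a \<bullet> x)\<^sup>2)}"
  define T where "T = real_of_ereal (\<tau> (k - 1))"
  define \<rho> where "\<rho> = xs \<bullet> x"
  define S where "S a = sqrt (1 - \<rho>\<^sup>2) * ((b a $ p)\<^sup>2 + (b a $ q)\<^sup>2)" for a
  have plane: "((a \<bullet> xs)\<^sup>2 - (a \<bullet> x)\<^sup>2)\<^sup>2 = (1 - \<rho>\<^sup>2) * ((b a $ p)\<^sup>2 - (b a $ q)\<^sup>2)\<^sup>2"
    "(a \<bullet> xs)\<^sup>2 + (a \<bullet> x)\<^sup>2 - 2 * \<rho> * (a \<bullet> xs) * (a \<bullet> x) = (1 - \<rho>\<^sup>2) * ((b a $ p)\<^sup>2 + (b a $ q)\<^sup>2)" for a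
    unfolding \<rho>_def b_def by (rule outer_diff_plane_coordinates[OF n sd])+
  have "\<bar>\<rho>\<bar> \<le> 1" using Cauchy_Schwarz_ineq2[of xs x] n by (simp add: \<rho>_def)
  then have \<rho>1: "\<rho>\<^sup>2 \<le> 1" by (simp add: abs_square_le_1)
  then have sqrt_sq: "(sqrt (1 - \<rho>\<^sup>2))\<^sup>2 = 1 - \<rho>\<^sup>2" by simp
  have T: "0 < T" "T \<le> d\<^sub>0" using last_threshold_pos[OF Q] d by (auto simp: T_def)
  have uvS: "\<bar>(a \<bullet> xs)\<^sup>2 - (a \<bullet> x)\<^sup>2\<bar> \<le> S a" for a
  proof -
    define y z where "y = (b a $ p)\<^sup>2" "z = (b a $ q)\<^sup>2"
    have yz: "0 \<le> y" "0 \<le> z" by (auto simp: y_z_def)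
    then have "(y - z)\<^sup>2 \<le> (y + z)\<^sup>2" by (intro abs_le_square_iff[THEN iffD1]) auto
    then have "((a \<bullet> xs)\<^sup>2 - (a \<bullet> x)\<^sup>2)\<^sup>2 \<le> (S a)\<^sup>2"
      using \<rho>1 unfolding plane(1) S_def power_mult_distrib sqrt_sq y_z_def[symmetric]
      by (intro mult_left_mono) auto
    moreover have "0 \<le> S a" using \<rho>1 by (simp add: S_def)
    ultimately show ?thesis by (simp add: abs_le_square_iff[symmetric])
  qed
  have ok: "a \<in> G"
    if "(a \<bullet> xs)\<^sup>2 < T \<or> (a \<bullet> xs)\<^sup>2 \<le> d\<^sub>0 \<and> (a \<bullet> x)\<^sup>2 \<le> d\<^sub>0
      \<or> ((a \<bullet> xs)\<^sup>2 - (a \<bullet> x)\<^sup>2)\<^sup>2 \<le> 2 * (d\<^sub>0 - T) * S a" for a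
  proof -
    obtain j where j: "j \<in> {1..k}" "\<tau> (j - 1) \<le> ereal ((a \<bullet> xs)\<^sup>2)" "ereal ((a \<bullet> xs)\<^sup>2) < \<tau> j"
      using cell_exists[OF Q, of "(a \<bullet> xs)\<^sup>2"] by auto
    have "((a \<bullet> xs)\<^sup>2 - (a \<bullet> x)\<^sup>2)\<^sup>2 / 2 - max (precision k \<tau>) (d\<^sub>0 - T) * S a - C / 2
      \<le> cell_cost k \<tau> ((a \<bullet> xs)\<^sup>2) ((a \<bullet> x)\<^sup>2)"
      unfolding cell_cost_cell[OF Q j] T_def
      by (rule cell_cost_ge[OF Q j d uvS C]) (use that in \<open>simp add: T_def\<close>)
    moreover have "((a \<bullet> xs)\<^sup>2 - (a \<bullet> x)\<^sup>2)\<^sup>2 / 2 = (1 - \<rho>\<^sup>2) / 2 * ((b a $ p)\<^sup>2 - (b a $ q)\<^sup>2)\<^sup>2"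
      by (simp add: plane(1))
    ultimately show ?thesis
      unfolding G_def low_def mem_Collect_eq \<rho>_def[symmetric] T_def[symmetric] S_def by (simp only: mult_ac)
  qed
  have [measurable]: "(\<lambda>v. b v $ i) \<in> borel_measurable borel" for i
    unfolding b_def by (rule matrix_vector_component_measurable)
  have [measurable]: "low \<in> borel_measurable borel" unfolding low_def[abs_def] by measurable
  have G[measurable]: "G \<in> sets borel" unfolding G_def by measurable
  have H[measurable]: "?H \<in> sets borel" by measurable
  have "emeasure ?N ?H \<le> emeasure ?N G"
  proof (cases "\<rho>\<^sup>2 < 1")
    \<comment> \<open>Here \<open>x\<close> and \<open>xs\<close> agree up to sign, so the two
      squared inner products coincide.\<close>
    case False
    then have "\<rho>\<^sup>2 = 1" using \<rho>1 by simp
    then have "a \<in> G" for a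
      using plane(1)[of a] by (intro ok) (simp add: S_def)
    then show ?thesis using H G by (intro emeasure_mono) auto
  next
    case True
    \<comment> \<open>\<open>S\<close> in terms of the two inner products, without eigenvectors, as
      the strip comparison has it; the second identity of \<open>plane\<close> shows that they
      agree.\<close>
    define S' where "S' a = ((a \<bullet> xs)\<^sup>2 + (a \<bullet> x)\<^sup>2 - 2 * (xs \<bullet> x) * (a \<bullet> xs) * (a \<bullet> x)) / sqrt (1 - (xs \<bullet> x)\<^sup>2)" for a
    have S': "S' a = S a" for a
    proof -
      have "(1 - \<rho>\<^sup>2) / sqrt (1 - \<rho>\<^sup>2) = sqrt (1 - \<rho>\<^sup>2)" using \<rho>1 by (intro real_div_sqrt) simp
      then show ?thesis unfolding S'_def S_def \<rho>_def[symmetric] plane(2) by (metis times_divide_eq_left)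
    qed
    have [measurable]: "S' \<in> borel_measurable borel" unfolding S'_def[abs_def] by measurable
    define Bd where "Bd = {a. T \<le> (a \<bullet> xs)\<^sup>2 \<and> (a \<bullet> xs)\<^sup>2 \<le> d\<^sub>0 \<and> d\<^sub>0 < (a \<bullet> x)\<^sup>2
      \<and> 2 * (d\<^sub>0 - T) * S' a < ((a \<bullet> xs)\<^sup>2 - (a \<bullet> x)\<^sup>2)\<^sup>2}"
    define Gd where "Gd = {a. d\<^sub>0 < (a \<bullet> xs)\<^sup>2
      \<and> ((a \<bullet> xs)\<^sup>2 - (a \<bullet> x)\<^sup>2)\<^sup>2 \<le> 2 * (d\<^sub>0 - T) * S' a}"
    have [measurable]: "Bd \<in> sets borel" "Gd \<in> sets borel" unfolding Bd_def Gd_def by measurable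
    have "emeasure ?N ?H \<le> emeasure ?N ((?H \<inter> G) \<union> Bd)"
    proof (rule emeasure_mono)
      show "?H \<subseteq> (?H \<inter> G) \<union> Bd"
      proof
        fix a assume a: "a \<in> ?H"
        show "a \<in> (?H \<inter> G) \<union> Bd"
        proof (rule ccontr)
          assume c: "a \<notin> (?H \<inter> G) \<union> Bd"
          then have "a \<notin> G" using a by blast
          then have "a \<in> Bd" using ok[of a] a unfolding Bd_def S' mem_Collect_eq by (meson not_le)
          then show False using c by blast
        qed
      qed
    qed simp
    also have "\<dots> \<le> emeasure ?N (?H \<inter> G) + emeasure ?N Bd"
      by (rule emeasure_subadditive) auto
    also have "emeasure ?N Bd \<le> emeasure ?N Gd"
      using std_gaussian_strip_comparison[OF n _ T] True
      unfolding Bd_def Gd_def S'_def \<rho>_def by simp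
    \<comment> \<open>The sets are disjoint: \<open>(a \<bullet> xs)\<^sup>2\<close> is at most
      \<open>d\<^sub>0\<close> on \<open>?H\<close> and larger on \<open>Gd\<close>.\<close>
    also have "emeasure ?N (?H \<inter> G) + emeasure ?N Gd = emeasure ?N ((?H \<inter> G) \<union> Gd)"
      by (rule plus_emeasure) (auto simp: Gd_def)
    also have "\<dots> \<le> emeasure ?N G"
      using ok unfolding Gd_def S' by (intro emeasure_mono) auto
    finally show ?thesis by (simp add: add_left_mono)
  qed
  then show ?thesis unfolding G_def low_def .
qed

text \<open>If the integrand is not integrable, \<open>integral\<close> has the default value
  0.\<close>

lemma lower_incomplete_gamma_nonneg: "0 \<le> lower_incomplete_gamma w \<alpha>"
proof (cases "(\<lambda>t. t powr (\<alpha> - 1) * exp (- t)) integrable_on {0..w}")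
  case True
  then show ?thesis unfolding lower_incomplete_gamma_def by (rule integral_nonneg) simp
qed (simp add: lower_incomplete_gamma_def not_integrable_integral)

section \<open>The bound for all samples\<close>

theorem proposition5:
  fixes M :: "'w measure"
    and m k :: nat
    and \<tau> :: "nat \<Rightarrow> ereal"
    and s :: "nat \<Rightarrow> real"
    and d\<^sub>0 :: real
    and xs x :: "real^'n"
    and a :: "nat \<Rightarrow> 'w \<Rightarrow> real^'n"
    and R D :: "real^'n^'n"
    and p q :: 'n
  assumes "CARD('n) \<ge> 2"
    and "is_quantizer k \<tau> s"
    and "xs \<in> sphere 0 1"
    and "x \<in> sphere 0 1"
    and "prob_space M"
    and "\<And>i. i \<in> {1..m} \<Longrightarrow> standard_gaussian M (a i)"
    and "prob_space.indep_vars M (\<lambda>_. borel) a {1..m}"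
    and "ereal d\<^sub>0 \<ge> \<tau> (k - 1)"
    and "spectral_decomposition p q R D (outer xs - outer x)"
  shows "measure M {\<omega> \<in> space M.
      (let y = (\<lambda>i. quantize k \<tau> s (\<bar>a i \<omega> \<bullet> xs\<bar>\<^sup>2));
           b = (\<lambda>i. transpose R *v a i \<omega>);
           \<rho> = \<bar>xs \<bullet> x\<bar>;
           \<delta> = precision k \<tau>
       in cost k \<tau> s m (\<lambda>i. a i \<omega>) y (outer x) \<ge>
            (1 - \<rho>\<^sup>2) / 2 * (\<Sum>i=1..m. ((b i $ p)\<^sup>2 - (b i $ q)\<^sup>2)\<^sup>2)
            - sqrt (1 - \<rho>\<^sup>2) * max \<delta> (d\<^sub>0 - real_of_ereal (\<tau> (k - 1)))
                * (\<Sum>i=1..m. (b i $ p)\<^sup>2 + (b i $ q)\<^sup>2)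
            - real m / 2 * max (\<delta>\<^sup>2 + 2 * \<delta> * d\<^sub>0) (precision_sq k \<tau> s))}
    \<ge> (lower_incomplete_gamma (d\<^sub>0 / 2) (1 / 2) / sqrt pi) ^ m"
proof -
  note Q = assms(2)
  interpret prob_space M by (rule assms(5))
  define T where "T = real_of_ereal (\<tau> (k - 1))"
  define \<rho> where "\<rho> = xs \<bullet> x"
  define w where "w = max (precision k \<tau>) (d\<^sub>0 - T)"
  define C where "C = max ((precision k \<tau>)\<^sup>2 + 2 * precision k \<tau> * d\<^sub>0) (precision_sq k \<tau> s)"
  define P where "P = lower_incomplete_gamma (d\<^sub>0 / 2) (1 / 2) / sqrt pi"
  define b where "b v = transpose R *v v" for v
  \<comment> \<open>The share of one sample: the constant term of the theorem is split into
    \<open>m\<close> equal parts.\<close>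
  define low where "low v = (1 - \<rho>\<^sup>2) / 2 * ((b v $ p)\<^sup>2 - (b v $ q)\<^sup>2)\<^sup>2
      - sqrt (1 - \<rho>\<^sup>2) * w * ((b v $ p)\<^sup>2 + (b v $ q)\<^sup>2) - C / 2" for v
  define c where "c v = cell_cost k \<tau> ((v \<bullet> xs)\<^sup>2) ((v \<bullet> x)\<^sup>2)" for v
  have n: "norm xs = 1" "norm x = 1" using assms(3,4) by auto
  have "ereal T = \<tau> (k - 1)"
    unfolding T_def using Q by (intro threshold_real[OF Q]) (auto simp: is_quantizer_def)
  then have Td: "T \<le> d\<^sub>0" using assms(8) by (metis ereal_less_eq(3))
  then have d0: "0 \<le> d\<^sub>0" using last_threshold_pos[OF Q] by (simp add: T_def)
  have "0 \<le> (precision k \<tau>)\<^sup>2 + 2 * precision k \<tau> * d\<^sub>0"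
    using precision_nonneg[OF Q] d0 by (intro add_nonneg_nonneg mult_nonneg_nonneg) auto
  then have C: "0 \<le> C" by (simp add: C_def)
  note [measurable] = matrix_vector_component_measurable[of "transpose R", folded b_def]
  have [measurable]: "low \<in> borel_measurable borel" "c \<in> borel_measurable borel"
    unfolding low_def[abs_def] c_def[abs_def] by measurable
  define G where "G = {v. low v \<le> c v}"
  have G: "G \<in> sets borel" unfolding G_def by measurable
  define E where "E = {\<omega> \<in> space M. (\<Sum>i=1..m. low (a i \<omega>)) \<le> (\<Sum>i=1..m. c (a i \<omega>))}"
  have sum_low: "(\<Sum>i=1..m. low (a i \<omega>)) = (1 - \<bar>\<rho>\<bar>\<^sup>2) / 2 * (\<Sum>i=1..m. ((b (a i \<omega>) $ p)\<^sup>2 - (b (a i \<omega>) $ q)\<^sup>2)\<^sup>2)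
            - sqrt (1 - \<bar>\<rho>\<bar>\<^sup>2) * w * (\<Sum>i=1..m. (b (a i \<omega>) $ p)\<^sup>2 + (b (a i \<omega>) $ q)\<^sup>2) - real m / 2 * C" for \<omega>
    by (simp add: low_def sum_subtractf sum_distrib_left)
  have target: "{\<omega> \<in> space M.
      (let y = (\<lambda>i. quantize k \<tau> s (\<bar>a i \<omega> \<bullet> xs\<bar>\<^sup>2));
           b = (\<lambda>i. transpose R *v a i \<omega>);
           \<rho> = \<bar>xs \<bullet> x\<bar>;
           \<delta> = precision k \<tau>
       in cost k \<tau> s m (\<lambda>i. a i \<omega>) y (outer x) \<ge>
            (1 - \<rho>\<^sup>2) / 2 * (\<Sum>i=1..m. ((b i $ p)\<^sup>2 - (b i $ q)\<^sup>2)\<^sup>2)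
            - sqrt (1 - \<rho>\<^sup>2) * max \<delta> (d\<^sub>0 - real_of_ereal (\<tau> (k - 1)))
                * (\<Sum>i=1..m. (b i $ p)\<^sup>2 + (b i $ q)\<^sup>2)
            - real m / 2 * max (\<delta>\<^sup>2 + 2 * \<delta> * d\<^sub>0) (precision_sq k \<tau> s))} = E"
    unfolding Let_def cost_eq_cell_cost[OF Q] E_def sum_low c_def b_def w_def C_def T_def \<rho>_def ..
  have dist: "distr M lborel (a i) = std_gaussian_measure" and meas: "a i \<in> borel_measurable M"
    if "i \<in> {1..m}" for i
    using assms(6)[OF that] distributed_measurable[of M lborel "a i"]
    by (auto simp: standard_gaussian_def std_gaussian_measure_def std_gaussian_density_def
        distributed_distr_eq_density)
  have E: "E \<in> sets M"
    unfolding E_def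
    by (intro borel_measurable_le borel_measurable_sum measurable_compose[OF meas]) auto
  have one: "P \<le> prob (a i -` G \<inter> space M)" if i: "i \<in> {1..m}" for i
  proof -
    have "ennreal P \<le> emeasure std_gaussian_measure G"
      using sample_bound_probability[OF Q n assms(9) Td[unfolded T_def] C]
      unfolding std_gaussian_inner_sq_le[OF n(1) d0] P_def G_def low_def c_def b_def w_def T_def \<rho>_def .
    also have "\<dots> = emeasure M (a i -` G \<inter> space M)"
      using meas[OF i] G by (subst dist[OF i, symmetric]) (simp add: emeasure_distr)
    finally show ?thesis by (simp add: emeasure_eq_measure)
  qed
  have P: "0 \<le> P" by (simp add: P_def lower_incomplete_gamma_nonneg)
  have "P ^ m \<le> prob E"
  \<comment> \<open>The product formula for independent events needs a nonempty index set.\<close>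
  proof (cases "m = 0")
    case True
    then have "E = space M" by (auto simp: E_def)
    then show ?thesis using True by (simp add: prob_space)
  next
    case False
    have "P ^ m = (\<Prod>i\<in>{1..m}. P)" by simp
    also have "\<dots> \<le> (\<Prod>i\<in>{1..m}. prob (a i -` G \<inter> space M))"
      using one P by (intro prod_mono) auto
    also have "\<dots> = prob (\<Inter>i\<in>{1..m}. a i -` G \<inter> space M)"
      using False G by (intro indep_varsD_finite[OF assms(7), symmetric]) auto
    also have "\<dots> \<le> prob E"
    proof (rule finite_measure_mono[OF _ E])
      show "(\<Inter>i\<in>{1..m}. a i -` G \<inter> space M) \<subseteq> E"
        using False by (auto simp: E_def G_def intro!: sum_mono)
    qed
    finally show ?thesis .
  qed
  then show ?thesis unfolding target P_def .
qed

end
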